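(* Let $g=C\left(\frac{1}{4F}dz^2+F(\eta^1)^2+(\eta^2)^2+(\eta^3)^2\right)$ with $F=F(z)>0$, $C=C(z)>0$. The complex structures $$J^\pm=\mp2F\frac{\partial}{\partial z}\otimes\eta^1\pm\frac1{2F}e_1\otimes dz-e_2\otimes\eta^3+e_3\otimes\eta^2$$ are compatible with $g$. Their $(1,1)$-forms $\omega^\pm=g(J^\pm\cdot,\cdot)$ are closed if and only if $C=C_0e^{\mp z}$ for a constant $C_0$, respectively.
   Context: $\eta^1,\eta^2,\eta^3$ is the left-invariant coframe on $\mathbb{S}^3$ with $d\eta^1=-2\eta^2\wedge\eta^3$ and cyclic permutations, with dual frame $e_1,e_2,e_3$. The metric lives on $I\times\mathbb{S}^3$, $I$ an interval with coordinate $z$. Compatible means $g(J\cdot,J\cdot)=g$. *)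

theory Defs
  imports "HOL-Analysis.Analysis"
begin

text \<open>
  Manifolds are rendered as embedded submanifolds of a Euclidean space, given by their carrier
  set \<open>M\<close>. Tangent vectors are ambient vectors; vector fields and forms are ambient functions of
  which only the values at points of \<open>M\<close> (and on tangent vectors) matter.
\<close>

section \<open>Calculus on an embedded submanifold\<close>

primrec differentiable_times ::
  "nat \<Rightarrow> 'a::real_normed_vector set \<Rightarrow> ('a \<Rightarrow> 'b::real_normed_vector) \<Rightarrow> bool" where
  "differentiable_times 0 U f \<longleftrightarrow> True"
| "differentiable_times (Suc k) U f \<longleftrightarrow>
     (\<forall>x\<in>U. f differentiable (at x)) \<and>
     (\<forall>v. differentiable_times k U (\<lambda>x. frechet_derivative f (at x) v))"

text \<open>\<open>C\<^sup>\<infinity>\<close> on \<open>M\<close>: restriction of a function that is \<open>C\<^sup>\<infinity>\<close> on an open neighbourhood of \<open>M\<close>.\<close>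

definition smooth_on :: "'a::real_normed_vector set \<Rightarrow> ('a \<Rightarrow> 'b::real_normed_vector) \<Rightarrow> bool" where
  "smooth_on M f \<longleftrightarrow> (\<exists>U h. open U \<and> M \<subseteq> U \<and> (\<forall>k. differentiable_times k U h) \<and>
     (\<forall>x\<in>M. h x = f x))"

definition tangent_space :: "'a::euclidean_space set \<Rightarrow> 'a \<Rightarrow> 'a set" where
  "tangent_space M p = {v. \<exists>\<gamma>::real \<Rightarrow> 'a. (\<forall>t. \<gamma> t \<in> M) \<and> \<gamma> 0 = p \<and>
     (\<gamma> has_vector_derivative v) (at 0)}"

definition vector_field :: "'a::euclidean_space set \<Rightarrow> ('a \<Rightarrow> 'a) \<Rightarrow> bool" where
  "vector_field M X \<longleftrightarrow> smooth_on M X \<and> (\<forall>p\<in>M. X p \<in> tangent_space M p)"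

text \<open>
  A derivative within a lower-dimensional \<open>M\<close> is not unique as a linear map on the ambient space,
  but its values on tangent vectors are; it is only ever applied to tangent vectors below.
\<close>

definition dir_deriv ::
  "'a::euclidean_space set \<Rightarrow> ('a \<Rightarrow> 'b::real_normed_vector) \<Rightarrow> 'a \<Rightarrow> 'a \<Rightarrow> 'b" where
  "dir_deriv M f p v = frechet_derivative f (at p within M) v"

definition lie_bracket ::
  "'a::euclidean_space set \<Rightarrow> ('a \<Rightarrow> 'a) \<Rightarrow> ('a \<Rightarrow> 'a) \<Rightarrow> 'a \<Rightarrow> 'a" where
  "lie_bracket M X Y p = dir_deriv M Y p (X p) - dir_deriv M X p (Y p)"

section \<open>Differential forms\<close>

definition linear_on_tangent ::
  "'a::euclidean_space set \<Rightarrow> 'a \<Rightarrow> ('a \<Rightarrow> 'b::real_vector) \<Rightarrow> bool" where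
  "linear_on_tangent M p \<phi> \<longleftrightarrow>
     (\<forall>u\<in>tangent_space M p. \<forall>v\<in>tangent_space M p. \<forall>a b.
        \<phi> (a *\<^sub>R u + b *\<^sub>R v) = a *\<^sub>R \<phi> u + b *\<^sub>R \<phi> v)"

definition one_form :: "'a::euclidean_space set \<Rightarrow> ('a \<Rightarrow> 'a \<Rightarrow> real) \<Rightarrow> bool" where
  "one_form M \<alpha> \<longleftrightarrow> (\<forall>p\<in>M. linear_on_tangent M p (\<alpha> p)) \<and>
     (\<forall>X. vector_field M X \<longrightarrow> smooth_on M (\<lambda>p. \<alpha> p (X p)))"

definition two_form :: "'a::euclidean_space set \<Rightarrow> ('a \<Rightarrow> 'a \<Rightarrow> 'a \<Rightarrow> real) \<Rightarrow> bool" where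
  "two_form M \<omega> \<longleftrightarrow>
     (\<forall>p\<in>M. \<forall>u\<in>tangent_space M p. linear_on_tangent M p (\<omega> p u) \<and>
        (\<forall>v\<in>tangent_space M p. \<omega> p u v = - \<omega> p v u)) \<and>
     (\<forall>X Y. vector_field M X \<and> vector_field M Y \<longrightarrow> smooth_on M (\<lambda>p. \<omega> p (X p) (Y p)))"

definition wedge ::
  "('a \<Rightarrow> 'a \<Rightarrow> real) \<Rightarrow> ('a \<Rightarrow> 'a \<Rightarrow> real) \<Rightarrow> 'a \<Rightarrow> 'a \<Rightarrow> 'a \<Rightarrow> real" where
  "wedge \<alpha> \<beta> p u v = \<alpha> p u * \<beta> p v - \<alpha> p v * \<beta> p u"

text \<open>Exterior derivatives evaluated on vector fields, by Cartan's invariant formula.\<close>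

definition ext_deriv_1 ::
  "'a::euclidean_space set \<Rightarrow> ('a \<Rightarrow> 'a \<Rightarrow> real) \<Rightarrow> ('a \<Rightarrow> 'a) \<Rightarrow> ('a \<Rightarrow> 'a) \<Rightarrow> 'a \<Rightarrow> real" where
  "ext_deriv_1 M \<alpha> X Y p =
     dir_deriv M (\<lambda>q. \<alpha> q (Y q)) p (X p) - dir_deriv M (\<lambda>q. \<alpha> q (X q)) p (Y p)
     - \<alpha> p (lie_bracket M X Y p)"

definition ext_deriv_2 ::
  "'a::euclidean_space set \<Rightarrow> ('a \<Rightarrow> 'a \<Rightarrow> 'a \<Rightarrow> real) \<Rightarrow>
   ('a \<Rightarrow> 'a) \<Rightarrow> ('a \<Rightarrow> 'a) \<Rightarrow> ('a \<Rightarrow> 'a) \<Rightarrow> 'a \<Rightarrow> real" where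
  "ext_deriv_2 M \<omega> X Y Z p =
     dir_deriv M (\<lambda>q. \<omega> q (Y q) (Z q)) p (X p)
     - dir_deriv M (\<lambda>q. \<omega> q (X q) (Z q)) p (Y p)
     + dir_deriv M (\<lambda>q. \<omega> q (X q) (Y q)) p (Z p)
     - \<omega> p (lie_bracket M X Y p) (Z p)
     + \<omega> p (lie_bracket M X Z p) (Y p)
     - \<omega> p (lie_bracket M Y Z p) (X p)"

definition has_ext_deriv ::
  "'a::euclidean_space set \<Rightarrow> ('a \<Rightarrow> 'a \<Rightarrow> real) \<Rightarrow> ('a \<Rightarrow> 'a \<Rightarrow> 'a \<Rightarrow> real) \<Rightarrow> bool" where
  "has_ext_deriv M \<alpha> \<omega> \<longleftrightarrow>
     (\<forall>X Y. vector_field M X \<longrightarrow> vector_field M Y \<longrightarrow>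
        (\<forall>p\<in>M. ext_deriv_1 M \<alpha> X Y p = \<omega> p (X p) (Y p)))"

definition closed_form :: "'a::euclidean_space set \<Rightarrow> ('a \<Rightarrow> 'a \<Rightarrow> 'a \<Rightarrow> real) \<Rightarrow> bool" where
  "closed_form M \<omega> \<longleftrightarrow>
     (\<forall>X Y Z. vector_field M X \<longrightarrow> vector_field M Y \<longrightarrow> vector_field M Z \<longrightarrow>
        (\<forall>p\<in>M. ext_deriv_2 M \<omega> X Y Z p = 0))"

section \<open>Complex structures\<close>

definition almost_complex_structure ::
  "'a::euclidean_space set \<Rightarrow> ('a \<Rightarrow> 'a \<Rightarrow> 'a) \<Rightarrow> bool" where
  "almost_complex_structure M J \<longleftrightarrow>
     (\<forall>p\<in>M. linear_on_tangent M p (J p) \<and>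
        (\<forall>u\<in>tangent_space M p. J p u \<in> tangent_space M p \<and> J p (J p u) = - u)) \<and>
     (\<forall>X. vector_field M X \<longrightarrow> smooth_on M (\<lambda>p. J p (X p)))"

definition nijenhuis ::
  "'a::euclidean_space set \<Rightarrow> ('a \<Rightarrow> 'a \<Rightarrow> 'a) \<Rightarrow> ('a \<Rightarrow> 'a) \<Rightarrow> ('a \<Rightarrow> 'a) \<Rightarrow> 'a \<Rightarrow> 'a" where
  "nijenhuis M J X Y p =
     lie_bracket M (\<lambda>q. J q (X q)) (\<lambda>q. J q (Y q)) p
     - J p (lie_bracket M (\<lambda>q. J q (X q)) Y p)
     - J p (lie_bracket M X (\<lambda>q. J q (Y q)) p)
     - lie_bracket M X Y p"

definition complex_structure ::
  "'a::euclidean_space set \<Rightarrow> ('a \<Rightarrow> 'a \<Rightarrow> 'a) \<Rightarrow> bool" where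
  "complex_structure M J \<longleftrightarrow> almost_complex_structure M J \<and>
     (\<forall>X Y. vector_field M X \<longrightarrow> vector_field M Y \<longrightarrow> (\<forall>p\<in>M. nijenhuis M J X Y p = 0))"

definition compatible ::
  "'a::euclidean_space set \<Rightarrow> ('a \<Rightarrow> 'a \<Rightarrow> 'a \<Rightarrow> real) \<Rightarrow> ('a \<Rightarrow> 'a \<Rightarrow> 'a) \<Rightarrow> bool" where
  "compatible M g J \<longleftrightarrow>
     (\<forall>p\<in>M. \<forall>u\<in>tangent_space M p. \<forall>v\<in>tangent_space M p. g p (J p u) (J p v) = g p u v)"

text \<open>A real 2-form is of type \<open>(1,1)\<close> iff it is \<open>J\<close>-invariant.\<close>

definition one_one_form ::
  "'a::euclidean_space set \<Rightarrow> ('a \<Rightarrow> 'a \<Rightarrow> 'a) \<Rightarrow> ('a \<Rightarrow> 'a \<Rightarrow> 'a \<Rightarrow> real) \<Rightarrow> bool" where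
  "one_one_form M J \<omega> \<longleftrightarrow> two_form M \<omega> \<and>
     (\<forall>p\<in>M. \<forall>u\<in>tangent_space M p. \<forall>v\<in>tangent_space M p. \<omega> p (J p u) (J p v) = \<omega> p u v)"

section \<open>The three-sphere as a Lie group\<close>

text \<open>The pair \<open>(a, b)\<close> stands for the quaternion \<open>a + b j\<close>.\<close>

type_synonym quat = "complex \<times> complex"

definition qmult :: "quat \<Rightarrow> quat \<Rightarrow> quat" where
  "qmult p q = (fst p * fst q - snd p * cnj (snd q), fst p * snd q + snd p * cnj (fst q))"

abbreviation S3 :: "quat set" where
  "S3 \<equiv> sphere 0 1"

text \<open>Left translation by \<open>p\<close> is the restriction of a linear map, hence is its own differential.\<close>

definition left_invariant :: "(quat \<Rightarrow> quat \<Rightarrow> real) \<Rightarrow> bool" where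
  "left_invariant \<alpha> \<longleftrightarrow>
     (\<forall>p\<in>S3. \<forall>q\<in>S3. \<forall>v\<in>tangent_space S3 q. \<alpha> (qmult p q) (qmult p v) = \<alpha> q v)"

definition dual_frame :: "(3 \<Rightarrow> quat \<Rightarrow> quat \<Rightarrow> real) \<Rightarrow> (3 \<Rightarrow> quat \<Rightarrow> quat) \<Rightarrow> bool" where
  "dual_frame \<eta> e \<longleftrightarrow>
     (\<forall>p\<in>S3. \<forall>i j. e j p \<in> tangent_space S3 p \<and> \<eta> i p (e j p) = (if i = j then 1 else 0))"

text \<open>
  Arithmetic in the index type \<open>3\<close> is modulo three, so the last clause is
  \<open>d\<eta>\<^sup>1 = -2 \<eta>\<^sup>2 \<and> \<eta>\<^sup>3\<close> together with its cyclic permutations. As \<open>S3\<close> is three-dimensional,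
  existence of the dual frame makes \<open>\<eta>\<close> a coframe.
\<close>

definition left_invariant_coframe ::
  "(3 \<Rightarrow> quat \<Rightarrow> quat \<Rightarrow> real) \<Rightarrow> (3 \<Rightarrow> quat \<Rightarrow> quat) \<Rightarrow> bool" where
  "left_invariant_coframe \<eta> e \<longleftrightarrow>
     (\<forall>i. one_form S3 (\<eta> i) \<and> left_invariant (\<eta> i)) \<and> dual_frame \<eta> e \<and>
     (\<forall>i. has_ext_deriv S3 (\<eta> i) (\<lambda>p u v. - 2 * wedge (\<eta> (i + 1)) (\<eta> (i + 2)) p u v))"

section \<open>The metric and the complex structures on \<open>I \<times> S3\<close>\<close>

definition metric_g ::
  "(3 \<Rightarrow> quat \<Rightarrow> quat \<Rightarrow> real) \<Rightarrow> (real \<Rightarrow> real) \<Rightarrow> (real \<Rightarrow> real) \<Rightarrow>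
   real \<times> quat \<Rightarrow> real \<times> quat \<Rightarrow> real \<times> quat \<Rightarrow> real" where
  "metric_g \<eta> F C = (\<lambda>(z, p) (a, u) (b, v).
     C z * (1 / (4 * F z) * (a * b) + F z * (\<eta> 1 p u * \<eta> 1 p v)
       + \<eta> 2 p u * \<eta> 2 p v + \<eta> 3 p u * \<eta> 3 p v))"

text \<open>The sign \<open>s = 1\<close> gives \<open>J\<^sup>+\<close> and \<open>s = -1\<close> gives \<open>J\<^sup>-\<close>; \<open>(1, 0)\<close> is the field \<open>\<partial>/\<partial>z\<close>.\<close>

definition complex_J ::
  "(3 \<Rightarrow> quat \<Rightarrow> quat \<Rightarrow> real) \<Rightarrow> (3 \<Rightarrow> quat \<Rightarrow> quat) \<Rightarrow> (real \<Rightarrow> real) \<Rightarrow> real \<Rightarrow>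
   real \<times> quat \<Rightarrow> real \<times> quat \<Rightarrow> real \<times> quat" where
  "complex_J \<eta> e F s = (\<lambda>(z, p) (a, u).
     (- s * 2 * F z * \<eta> 1 p u) *\<^sub>R (1, 0)
     + (s * (1 / (2 * F z)) * a) *\<^sub>R (0, e 1 p)
     - \<eta> 3 p u *\<^sub>R (0, e 2 p)
     + \<eta> 2 p u *\<^sub>R (0, e 3 p))"

definition fundamental_form ::
  "('a \<Rightarrow> 'a \<Rightarrow> 'a \<Rightarrow> real) \<Rightarrow> ('a \<Rightarrow> 'a \<Rightarrow> 'a) \<Rightarrow> 'a \<Rightarrow> 'a \<Rightarrow> 'a \<Rightarrow> real" where
  "fundamental_form g J p u v = g p (J p u) v"

end

theory Submission
  imports Defs
begin

text \<open>
  The whole computation is done in the moving frame. A vector field \<open>X\<close> on \<open>I \<times> S3\<close> is described by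
  its components \<open>x0 = dz(X)\<close> and \<open>xi = \<eta>\<^sup>i(X)\<close>, and in these components \<open>J\<close>, \<open>g\<close> and \<open>\<omega>\<close> are explicit.
  The geometry of the sphere enters only through Cartan's formula for the components of a bracket,
  \<open>\<eta>\<^sup>i([X,Y]) = X(yi) - Y(xi) - d\<eta>\<^sup>i(X,Y)\<close> with \<open>d\<eta>\<^sup>i = -2 \<eta>\<^sup>i\<^sup>+\<^sup>1 \<and> \<eta>\<^sup>i\<^sup>+\<^sup>2\<close> (lemma \<open>eta_bracket\<close>), together
  with \<open>dz([X,Y]) = X(y0) - Y(x0)\<close> (lemma \<open>fst_bracket\<close>).

  Integrability (lemma \<open>nijenhuis_J\<close>): when the components of the Nijenhuis tensor are expanded by
  these formulas, every derivative of a component of \<open>X\<close> or \<open>Y\<close> cancels, and so do the remaining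
  terms: \<open>J\<close> turns the plane of \<open>e\<^sub>2\<close> and \<open>e\<^sub>3\<close> by a right angle, as \<open>[e\<^sub>1, \<cdot>]\<close> does up to a factor. Compatibility and type \<open>(1,1)\<close> are identities in the components.

  Closedness (lemma \<open>ext_deriv_fundamental\<close>): the fundamental form is
  \<open>\<omega> = C ((s/2) dz \<and> \<eta>\<^sup>1 + \<eta>\<^sup>2 \<and> \<eta>\<^sup>3)\<close>. Since \<open>d\<eta>\<^sup>1 = -2 \<eta>\<^sup>2 \<and> \<eta>\<^sup>3\<close> and \<open>d(\<eta>\<^sup>2 \<and> \<eta>\<^sup>3) = 0\<close>, its exterior
  derivative is \<open>d\<omega> = (C' + s C) dz \<and> \<eta>\<^sup>2 \<and> \<eta>\<^sup>3\<close>. So \<open>\<omega>\<close> is closed iff \<open>C' = -s C\<close> on \<open>I\<close>, and on an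
  interval the solutions of this equation are the multiples of \<open>exp (-s z)\<close>.

  Two facts make the pointwise hypotheses on \<open>\<eta>\<close> and \<open>e\<close> usable. Left invariance forces
  \<open>\<eta>\<^sup>i\<^sub>p(u) = \<langle>p w\<^sub>i, u\<rangle>\<close> for constant quaternions \<open>w\<^sub>i\<close> (lemma \<open>eta_eq_inner\<close>), and it forces \<open>e\<^sub>i(p)\<close>
  to be \<open>p e\<^sub>i(1)\<close> (lemma \<open>e_eq\<close>). Hence the frame and the coframe are restrictions of linear maps; in
  particular they are smooth, and the structure equation on \<open>S3\<close> becomes an algebraic identity at each
  point, which carries over to the product.
\<close>

section \<open>Calculus of smooth functions\<close>

lemma differentiable_times_cong:
  assumes "open U"
  shows "differentiable_times k U f \<Longrightarrow> (\<And>x. x \<in> U \<Longrightarrow> f x = g x) \<Longrightarrow> differentiable_times k U g"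
proof (induction k arbitrary: f g)
  case (Suc k)
  have g: "(g has_derivative frechet_derivative f (at x)) (at x)" if "x \<in> U" for x
  proof (rule has_derivative_transform_within_open[OF _ assms that])
    show "(f has_derivative frechet_derivative f (at x)) (at x)"
      using Suc.prems(1) that by (simp add: frechet_derivative_works[symmetric])
  qed (rule Suc.prems(2))
  have "differentiable_times k U (\<lambda>x. frechet_derivative g (at x) v)" for v
  proof (rule Suc.IH)
    show "differentiable_times k U (\<lambda>x. frechet_derivative f (at x) v)"
      using Suc.prems(1) by simp
  qed (simp add: frechet_derivative_at[OF g])
  moreover have "\<forall>x\<in>U. g differentiable (at x)"
    using g unfolding differentiable_def by blast
  ultimately show ?case by simp
qed simp

text \<open>
  Derivatives that are known explicitly can be used in place of the chosen Frechet derivative; the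
  closure properties under sums, products and compositions are inductions with this rule as the step.
\<close>
lemma differentiable_times_SucI:
  assumes "open U" and f': "\<And>x. x \<in> U \<Longrightarrow> (f has_derivative f' x) (at x)"
    and "\<And>v. differentiable_times k U (\<lambda>x. f' x v)"
  shows "differentiable_times (Suc k) U f"
proof -
  have "differentiable_times k U (\<lambda>x. frechet_derivative f (at x) v)" for v
    by (rule differentiable_times_cong[OF assms(1,3)]) (simp add: frechet_derivative_at[OF f'])
  moreover have "\<forall>x\<in>U. f differentiable (at x)"
    using f' unfolding differentiable_def by blast
  ultimately show ?thesis by simp
qed

lemma has_derivative_of_differentiable_times:
  "differentiable_times (Suc k) U f \<Longrightarrow> x \<in> U \<Longrightarrow>
    (f has_derivative frechet_derivative f (at x)) (at x)"
  by (simp add: frechet_derivative_works[symmetric])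

lemma differentiable_times_SucD: "differentiable_times (Suc k) U f \<Longrightarrow> differentiable_times k U f"
  by (induction k arbitrary: f) auto

lemma differentiable_times_mono:
  "differentiable_times k U f \<Longrightarrow> V \<subseteq> U \<Longrightarrow> differentiable_times k V f"
  by (induction k arbitrary: f) auto

lemma differentiable_times_const: "open U \<Longrightarrow> differentiable_times k U (\<lambda>x. c)"
  by (induction k arbitrary: c) auto

lemma differentiable_times_bounded_linear:
  assumes "bounded_linear L" "open U"
  shows "differentiable_times k U L"
proof (cases k)
  case (Suc n)
  have "differentiable_times (Suc n) U L"
    by (rule differentiable_times_SucI[OF assms(2) bounded_linear_imp_has_derivative[OF assms(1)]])
      (rule differentiable_times_const[OF assms(2)])
  then show ?thesis using Suc by simp
qed simp

lemma differentiable_times_add: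
  assumes "open U"
  shows "differentiable_times k U f \<Longrightarrow> differentiable_times k U g \<Longrightarrow>
    differentiable_times k U (\<lambda>x. f x + g x)"
proof (induction k arbitrary: f g)
  case (Suc k)
  show ?case
    by (rule differentiable_times_SucI[OF assms has_derivative_add[OF
          has_derivative_of_differentiable_times[OF Suc.prems(1)]
          has_derivative_of_differentiable_times[OF Suc.prems(2)]]])
      (use Suc assms in auto)
qed simp

lemma differentiable_times_linear_comp:
  assumes "open U" "bounded_linear L"
  shows "differentiable_times k U f \<Longrightarrow> differentiable_times k U (\<lambda>x. L (f x))"
proof (induction k arbitrary: f)
  case (Suc k)
  show ?case
    by (rule differentiable_times_SucI[OF assms(1) bounded_linear.has_derivative[OF assms(2)
          has_derivative_of_differentiable_times[OF Suc.prems]]])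
      (use Suc assms in auto)
qed simp

text \<open>
  Leibniz' rule expresses the derivative by products of functions of one order less, so the
  induction hypothesis has to range over both factors.
\<close>
lemma differentiable_times_bilinear:
  assumes "open U" "bounded_bilinear b"
  shows "differentiable_times k U f \<Longrightarrow> differentiable_times k U g \<Longrightarrow>
    differentiable_times k U (\<lambda>x. b (f x) (g x))"
proof (induction k arbitrary: f g)
  case (Suc k)
  note d = differentiable_times_SucD[OF Suc.prems(1)] differentiable_times_SucD[OF Suc.prems(2)]
  show ?case
    by (rule differentiable_times_SucI[OF assms(1) bounded_bilinear.FDERIV[OF assms(2)
          has_derivative_of_differentiable_times[OF Suc.prems(1)]
          has_derivative_of_differentiable_times[OF Suc.prems(2)]]])
      (use Suc assms d in \<open>auto intro!: differentiable_times_add\<close>)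
qed simp

lemma differentiable_times_comp_linear:
  assumes "open U" "bounded_linear L"
  shows "differentiable_times k U f \<Longrightarrow> differentiable_times k (L -` U) (\<lambda>x. f (L x))"
proof (induction k arbitrary: f)
  case (Suc k)
  have op: "open (L -` U)"
    using assms by (intro open_vimage linear_continuous_on) auto
  show ?case
  proof (rule differentiable_times_SucI[OF op])
    show "((\<lambda>x. f (L x)) has_derivative (\<lambda>v. frechet_derivative f (at (L x)) (L v))) (at x)"
      if "x \<in> L -` U" for x
      by (rule has_derivative_compose[OF bounded_linear_imp_has_derivative[OF assms(2)]])
        (use that has_derivative_of_differentiable_times[OF Suc.prems] in auto)
    show "differentiable_times k (L -` U) (\<lambda>x. frechet_derivative f (at (L x)) (L v))" for v
      by (rule Suc.IH[of "\<lambda>y. frechet_derivative f (at y) (L v)"]) (use Suc.prems in auto)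
  qed
qed simp

text \<open>
  The derivative of \<open>1/f\<close> is a product involving \<open>1/f\<close> itself, which the induction hypothesis
  controls to one order less.
\<close>
lemma differentiable_times_inverse:
  fixes f :: "'a::real_normed_vector \<Rightarrow> real"
  assumes "open U" "\<And>x. x \<in> U \<Longrightarrow> f x \<noteq> 0"
  shows "differentiable_times k U f \<Longrightarrow> differentiable_times k U (\<lambda>x. inverse (f x))"
proof (induction k)
  case (Suc k)
  have i: "differentiable_times k U (\<lambda>x. inverse (f x))"
    by (rule Suc.IH[OF differentiable_times_SucD[OF Suc.prems]])
  note mult = differentiable_times_bilinear[OF assms(1) bounded_bilinear_mult]
  have "differentiable_times k U (\<lambda>x. - (inverse (f x) * frechet_derivative f (at x) v * inverse (f x)))" for v
    by (intro differentiable_times_linear_comp[OF assms(1) bounded_linear_minus[OF bounded_linear_ident]]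
       mult i) (use Suc.prems in auto)
  note d = this
  show ?case
    by (rule differentiable_times_SucI[OF assms(1) Deriv.has_derivative_inverse[OF assms(2)
          has_derivative_of_differentiable_times[OF Suc.prems]]]) (assumption | rule d)+
qed simp

lemma smooth_on_cong: "smooth_on M f \<Longrightarrow> (\<And>x. x \<in> M \<Longrightarrow> f x = g x) \<Longrightarrow> smooth_on M g"
  unfolding smooth_on_def by metis

lemma smooth_on_const: "smooth_on M (\<lambda>x. c)"
  unfolding smooth_on_def
  by (intro exI[of _ UNIV] exI[of _ "\<lambda>x. c"]) (auto intro: differentiable_times_const)

lemma smooth_on_bounded_linear: "bounded_linear L \<Longrightarrow> smooth_on M L"
  unfolding smooth_on_def
  by (intro exI[of _ UNIV] exI[of _ L]) (auto intro: differentiable_times_bounded_linear)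

lemma smooth_on_linear_comp: "bounded_linear L \<Longrightarrow> smooth_on M f \<Longrightarrow> smooth_on M (\<lambda>x. L (f x))"
  unfolding smooth_on_def by (metis differentiable_times_linear_comp)

lemma smooth_on_bilinear:
  assumes "bounded_bilinear b" "smooth_on M f" "smooth_on M g"
  shows "smooth_on M (\<lambda>x. b (f x) (g x))"
proof -
  obtain U h where U: "open U" "M \<subseteq> U" "\<And>k. differentiable_times k U h" "\<forall>x\<in>M. h x = f x"
    using assms(2) unfolding smooth_on_def by blast
  obtain V k where V: "open V" "M \<subseteq> V" "\<And>n. differentiable_times n V k" "\<forall>x\<in>M. k x = g x"
    using assms(3) unfolding smooth_on_def by blast
  have "differentiable_times n (U \<inter> V) (\<lambda>x. b (h x) (k x))" for n
    using U V by (intro differentiable_times_bilinear[OF open_Int assms(1)] differentiable_times_mono[OF U(3)]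
        differentiable_times_mono[OF V(3)]) auto
  then show ?thesis
    unfolding smooth_on_def using U V
    by (intro exI[of _ "U \<inter> V"] exI[of _ "\<lambda>x. b (h x) (k x)"]) auto
qed

lemma smooth_on_add:
  assumes "smooth_on M f" "smooth_on M g"
  shows "smooth_on M (\<lambda>x. f x + g x)"
proof -
  obtain U h where U: "open U" "M \<subseteq> U" "\<And>k. differentiable_times k U h" "\<forall>x\<in>M. h x = f x"
    using assms(1) unfolding smooth_on_def by blast
  obtain V k where V: "open V" "M \<subseteq> V" "\<And>n. differentiable_times n V k" "\<forall>x\<in>M. k x = g x"
    using assms(2) unfolding smooth_on_def by blast
  have "differentiable_times n (U \<inter> V) (\<lambda>x. h x + k x)" for n
    using U V by (intro differentiable_times_add[OF open_Int] differentiable_times_mono[OF U(3)]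
        differentiable_times_mono[OF V(3)]) auto
  then show ?thesis
    unfolding smooth_on_def using U V
    by (intro exI[of _ "U \<inter> V"] exI[of _ "\<lambda>x. h x + k x"]) auto
qed

lemmas smooth_on_mult = smooth_on_bilinear[OF bounded_bilinear_mult]
  and smooth_on_scaleR = smooth_on_bilinear[OF bounded_bilinear_scaleR]
  and smooth_on_inner = smooth_on_bilinear[OF bounded_bilinear_inner]
  and smooth_on_fst = smooth_on_linear_comp[OF bounded_linear_fst]
  and smooth_on_snd = smooth_on_linear_comp[OF bounded_linear_snd]
  and smooth_on_minus = smooth_on_linear_comp[OF bounded_linear_minus[OF bounded_linear_ident]]

lemma smooth_on_diff: "smooth_on M f \<Longrightarrow> smooth_on M g \<Longrightarrow> smooth_on M (\<lambda>x. f x - g x)"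
  using smooth_on_add[of M f "\<lambda>x. - g x"] smooth_on_minus[of M g] by simp

text \<open>
  Pairing is the sum of the two linear inclusions of the factors.
\<close>
lemma smooth_on_Pair:
  assumes "smooth_on M f" "smooth_on M g"
  shows "smooth_on M (\<lambda>x. (f x, g x))"
proof -
  have "smooth_on M (\<lambda>x. (f x, 0) + (0, g x))"
    by (intro smooth_on_add smooth_on_linear_comp[OF _ assms(1)] smooth_on_linear_comp[OF _ assms(2)]
        bounded_linear_Pair bounded_linear_ident bounded_linear_zero)
  then show ?thesis by simp
qed

lemma smooth_on_comp_fst:
  assumes "smooth_on A f"
  shows "smooth_on (A \<times> B) (\<lambda>q. f (fst q))"
proof -
  obtain U h where U: "open U" "A \<subseteq> U" "\<And>k. differentiable_times k U h" "\<forall>x\<in>A. h x = f x"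
    using assms unfolding smooth_on_def by blast
  have "open (fst -` U :: ('a \<times> 'c) set)"
    using U(1) by (intro open_vimage continuous_on_fst continuous_on_id) auto
  then show ?thesis
    unfolding smooth_on_def using U differentiable_times_comp_linear[OF U(1) bounded_linear_fst U(3)]
    by (intro exI[of _ "fst -` U"] exI[of _ "\<lambda>q. h (fst q)"]) auto
qed

text \<open>
  The extension of \<open>f\<close> may vanish away from \<open>M\<close>; the open set where it does not is a smaller
  neighbourhood of \<open>M\<close>.
\<close>
lemma smooth_on_inverse:
  fixes f :: "'a::real_normed_vector \<Rightarrow> real"
  assumes "smooth_on M f" "\<And>x. x \<in> M \<Longrightarrow> f x \<noteq> 0"
  shows "smooth_on M (\<lambda>x. inverse (f x))"
proof -
  obtain U h where U: "open U" "M \<subseteq> U" "\<And>k. differentiable_times k U h" "\<forall>x\<in>M. h x = f x"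
    using assms(1) unfolding smooth_on_def by blast
  have "continuous_on U h"
    using U(3)[of "Suc 0"]
    by (auto intro!: continuous_at_imp_continuous_on differentiable_imp_continuous_within)
  then have op: "open (U \<inter> h -` (- {0}))"
    using U(1) by (intro continuous_open_preimage) auto
  have "differentiable_times n (U \<inter> h -` (- {0})) (\<lambda>x. inverse (h x))" for n
    by (intro differentiable_times_inverse[OF op] differentiable_times_mono[OF U(3)]) auto
  then show ?thesis
    unfolding smooth_on_def using U op assms(2)
    by (intro exI[of _ "U \<inter> h -` (- {0})"] exI[of _ "\<lambda>x. inverse (h x)"]) auto
qed

lemma smooth_on_imp_has_derivative:
  assumes "smooth_on M f" "p \<in> M"
  obtains f' where "(f has_derivative f') (at p within M)"
proof -
  obtain U h where U: "open U" "M \<subseteq> U" "\<And>k. differentiable_times k U h" "\<forall>x\<in>M. h x = f x"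
    using assms(1) unfolding smooth_on_def by blast
  have "(h has_derivative frechet_derivative h (at p)) (at p)"
    using has_derivative_of_differentiable_times[OF U(3)[of "Suc 0"]] U(2) assms(2) by blast
  then have "(h has_derivative frechet_derivative h (at p)) (at p within M)"
    by (rule has_derivative_at_withinI)
  then have "(f has_derivative frechet_derivative h (at p)) (at p within M)"
    by (rule has_derivative_transform[rotated 2]) (use U(4) assms(2) in auto)
  then show ?thesis by (rule that)
qed

section \<open>Directional derivatives along tangent vectors\<close>

lemma has_derivative_along_curve:
  assumes "(f has_derivative f') (at p within M)" "\<And>t. \<gamma> t \<in> M" "\<gamma> 0 = p"
    and "(\<gamma> has_vector_derivative v) (at 0)"
  shows "((\<lambda>t. f (\<gamma> t)) has_vector_derivative f' v) (at 0)"
proof -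
  have "(f has_derivative f') (at (\<gamma> 0) within range \<gamma>)"
    using assms(1,2,3) by (auto intro: has_derivative_subset)
  from has_derivative_in_compose[OF assms(4)[unfolded has_vector_derivative_def] this]
  have "((\<lambda>t. f (\<gamma> t)) has_derivative (\<lambda>h. f' (h *\<^sub>R v))) (at 0)" .
  then show ?thesis
    using has_derivative_bounded_linear[OF assms(1)]
    by (simp add: has_vector_derivative_def linear_simps)
qed

text \<open>
  On a tangent vector every derivative within \<open>M\<close> takes the same value, the velocity of \<open>f\<close> along a
  curve in \<open>M\<close>. This makes \<open>dir_deriv\<close>, which uses an arbitrarily chosen derivative, computable.
\<close>
lemma dir_deriv_eqI:
  assumes "(f has_derivative f') (at p within M)" "v \<in> tangent_space M p"
  shows "dir_deriv M f p v = f' v"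
proof -
  obtain \<gamma> where \<gamma>: "\<And>t. \<gamma> t \<in> M" "\<gamma> 0 = p" "(\<gamma> has_vector_derivative v) (at (0::real))"
    using assms(2) unfolding tangent_space_def by blast
  have "(f has_derivative frechet_derivative f (at p within M)) (at p within M)"
    using assms(1) differentiableI frechet_derivative_works by blast
  from vector_derivative_unique_at[OF has_derivative_along_curve[OF this \<gamma>]
      has_derivative_along_curve[OF assms(1) \<gamma>]]
  show ?thesis unfolding dir_deriv_def .
qed

text \<open>
  Only the values on \<open>M\<close> count, so formulas valid on \<open>M\<close> alone may be substituted under
  \<open>dir_deriv\<close>.
\<close>
lemma dir_deriv_cong:
  assumes "\<And>q. q \<in> M \<Longrightarrow> f q = g q" "p \<in> M"
  shows "dir_deriv M f p v = dir_deriv M g p v"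
proof -
  have "(f has_derivative D) (at p within M) \<longleftrightarrow> (g has_derivative D) (at p within M)" for D
    using assms by (auto elim!: has_derivative_transform[rotated 2])
  then show ?thesis
    unfolding dir_deriv_def frechet_derivative_def by simp
qed

lemma dir_deriv_const: "v \<in> tangent_space M p \<Longrightarrow> dir_deriv M (\<lambda>q. c) p v = 0"
  by (rule dir_deriv_eqI) (auto intro: derivative_intros)

lemma dir_deriv_linear_comp:
  assumes "bounded_linear L" "smooth_on M f" "p \<in> M" "v \<in> tangent_space M p"
  shows "dir_deriv M (\<lambda>q. L (f q)) p v = L (dir_deriv M f p v)"
proof -
  obtain f' where f': "(f has_derivative f') (at p within M)"
    using smooth_on_imp_has_derivative assms(2,3) by blast
  from dir_deriv_eqI[OF bounded_linear.has_derivative[OF assms(1) f'] assms(4)]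
  show ?thesis by (simp add: dir_deriv_eqI[OF f' assms(4)])
qed

lemma dir_deriv_add:
  assumes "smooth_on M f" "smooth_on M g" "p \<in> M" "v \<in> tangent_space M p"
  shows "dir_deriv M (\<lambda>q. f q + g q) p v = dir_deriv M f p v + dir_deriv M g p v"
proof -
  obtain f' g' where f': "(f has_derivative f') (at p within M)" and g': "(g has_derivative g') (at p within M)"
    using smooth_on_imp_has_derivative assms(1,2,3) by metis
  from dir_deriv_eqI[OF has_derivative_add[OF f' g'] assms(4)]
  show ?thesis by (simp add: dir_deriv_eqI[OF f' assms(4)] dir_deriv_eqI[OF g' assms(4)])
qed

lemma dir_deriv_bilinear:
  assumes "bounded_bilinear b" "smooth_on M f" "smooth_on M g" "p \<in> M" "v \<in> tangent_space M p"
  shows "dir_deriv M (\<lambda>q. b (f q) (g q)) p v = b (f p) (dir_deriv M g p v) + b (dir_deriv M f p v) (g p)"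
proof -
  obtain f' g' where f': "(f has_derivative f') (at p within M)" and g': "(g has_derivative g') (at p within M)"
    using smooth_on_imp_has_derivative assms(2,3,4) by metis
  from dir_deriv_eqI[OF bounded_bilinear.FDERIV[OF assms(1) f' g'] assms(5)]
  show ?thesis by (simp add: dir_deriv_eqI[OF f' assms(5)] dir_deriv_eqI[OF g' assms(5)])
qed

lemma dir_deriv_bounded_linear:
  "bounded_linear L \<Longrightarrow> v \<in> tangent_space M p \<Longrightarrow> dir_deriv M L p v = L v"
  by (rule dir_deriv_eqI) (auto intro: bounded_linear_imp_has_derivative)

lemmas dir_deriv_mult = dir_deriv_bilinear[OF bounded_bilinear_mult]
  and dir_deriv_inner = dir_deriv_bilinear[OF bounded_bilinear_inner]
  and dir_deriv_fst = dir_deriv_linear_comp[OF bounded_linear_fst]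
  and dir_deriv_minus = dir_deriv_linear_comp[OF bounded_linear_minus[OF bounded_linear_ident]]

lemma dir_deriv_diff:
  assumes "smooth_on M f" "smooth_on M g" "p \<in> M" "v \<in> tangent_space M p"
  shows "dir_deriv M (\<lambda>q. f q - g q) p v = dir_deriv M f p v - dir_deriv M g p v"
  using dir_deriv_add[OF assms(1) smooth_on_minus[OF assms(2)] assms(3,4)]
    dir_deriv_minus[OF assms(2,3,4)] by simp

lemma dir_deriv_comp_fst:
  fixes f :: "real \<Rightarrow> real"
  assumes "(f has_real_derivative f') (at (fst p))" "v \<in> tangent_space M p"
  shows "dir_deriv M (\<lambda>q. f (fst q)) p v = f' * fst v"
proof (rule dir_deriv_eqI[OF _ assms(2)])
  show "((\<lambda>q. f (fst q)) has_derivative (\<lambda>v. f' * fst v)) (at p within M)"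
    using has_derivative_compose[OF bounded_linear_imp_has_derivative[OF bounded_linear_fst]
        assms(1)[unfolded has_field_derivative_def]] .
qed

section \<open>Tangent spaces of the sphere and of a product\<close>

text \<open>
  A curve on the sphere has constant \<open>\<gamma> \<bullet> \<gamma>\<close>, hence velocity orthogonal to its position. Conversely
  the normalisation of \<open>p + t v\<close> has velocity \<open>v\<close>, since the norm is stationary at \<open>t = 0\<close>.
\<close>
lemma tangent_space_sphere:
  fixes p :: "'a::euclidean_space"
  assumes "p \<in> sphere 0 1"
  shows "tangent_space (sphere 0 1) p = {v. p \<bullet> v = 0}"
proof (intro equalityI subsetI)
  fix v assume "v \<in> tangent_space (sphere 0 1) p"
  then obtain \<gamma> where \<gamma>: "\<And>t. norm (\<gamma> t) = 1" "\<gamma> 0 = p" "(\<gamma> has_vector_derivative v) (at (0::real))"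
    unfolding tangent_space_def by auto
  from has_derivative_inner[OF \<gamma>(3,3)[unfolded has_vector_derivative_def]]
  have "((\<lambda>t. \<gamma> t \<bullet> \<gamma> t) has_derivative (\<lambda>h. p \<bullet> (h *\<^sub>R v) + (h *\<^sub>R v) \<bullet> p)) (at 0)"
    by (simp add: \<gamma>(2))
  moreover have "(\<lambda>t. \<gamma> t \<bullet> \<gamma> t) = (\<lambda>t. 1)"
    using \<gamma>(1) by (simp add: norm_eq_1)
  ultimately have "(\<lambda>h. p \<bullet> (h *\<^sub>R v) + (h *\<^sub>R v) \<bullet> p) = (\<lambda>h. 0)"
    by (metis has_derivative_const has_derivative_unique)
  from fun_cong[OF this, of 1] show "v \<in> {v. p \<bullet> v = 0}"
    by (simp add: inner_commute)
next
  fix v assume "v \<in> {v. p \<bullet> v = 0}"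
  then have v: "p \<bullet> v = 0" by simp
  define n where "n t = norm (p + t *\<^sub>R v)" for t :: real
  have n2: "(n t)\<^sup>2 = 1 + t\<^sup>2 * (v \<bullet> v)" for t
    unfolding n_def power2_norm_eq_inner using assms v
    by (simp add: algebra_simps inner_commute power2_eq_square norm_eq_1)
  have n_pos: "n t \<noteq> 0" for t
  proof -
    have "0 < 1 + t\<^sup>2 * (v \<bullet> v)" by (simp add: add_pos_nonneg)
    then show ?thesis using n2[of t] by auto
  qed
  have n: "n t = sqrt (1 + t\<^sup>2 * (v \<bullet> v))" for t
    using n2[of t] by (metis abs_norm_cancel n_def real_sqrt_abs)
  have dn: "((\<lambda>t. inverse (n t)) has_real_derivative 0) (at 0)"
    unfolding n by (auto intro!: derivative_eq_intros)
  have "((\<lambda>t. inverse (n t) *\<^sub>R (p + t *\<^sub>R v)) has_vector_derivative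
      (inverse (n 0) *\<^sub>R v + 0 *\<^sub>R (p + 0 *\<^sub>R v))) (at 0)"
    by (rule has_vector_derivative_scaleR[OF dn]) (auto intro!: derivative_eq_intros)
  then have "((\<lambda>t. inverse (n t) *\<^sub>R (p + t *\<^sub>R v)) has_vector_derivative v) (at 0)"
    using assms by (simp add: n)
  moreover have "inverse (n t) *\<^sub>R (p + t *\<^sub>R v) \<in> sphere 0 1" for t
    using n_pos[of t] by (simp add: n_def)
  moreover have "inverse (n 0) *\<^sub>R (p + 0 *\<^sub>R v) = p"
    by (simp add: n)
  ultimately show "v \<in> tangent_space (sphere 0 1) p"
    unfolding tangent_space_def
    by (intro CollectI exI[of _ "\<lambda>t. inverse (n t) *\<^sub>R (p + t *\<^sub>R v)"]) auto
qed

text \<open>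
  Curves witnessing tangency must stay in the manifold for all times; replacing \<open>z + t a\<close> by
  \<open>z + (sin (c t) / c) a\<close> with large \<open>c\<close> keeps the first factor in a small ball around \<open>z\<close>.
\<close>
lemma tangent_space_open_Times:
  fixes A :: "'a::euclidean_space set" and N :: "'b::euclidean_space set"
  assumes "open A" "z \<in> A"
  shows "tangent_space (A \<times> N) (z, p) = UNIV \<times> tangent_space N p"
proof (intro equalityI subsetI)
  fix x assume "x \<in> tangent_space (A \<times> N) (z, p)"
  then obtain \<gamma> where \<gamma>: "\<And>t. \<gamma> t \<in> A \<times> N" "\<gamma> 0 = (z, p)" "(\<gamma> has_vector_derivative x) (at (0::real))"
    unfolding tangent_space_def by blast
  have "((\<lambda>t. snd (\<gamma> t)) has_vector_derivative snd x) (at 0)"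
    by (rule bounded_linear.has_vector_derivative[OF bounded_linear_snd \<gamma>(3)])
  moreover have "\<forall>t. snd (\<gamma> t) \<in> N" "snd (\<gamma> 0) = p"
    using \<gamma>(1,2) by (auto simp: mem_Times_iff)
  ultimately have "snd x \<in> tangent_space N p"
    unfolding tangent_space_def by (intro CollectI exI[of _ "\<lambda>t. snd (\<gamma> t)"]) auto
  then show "x \<in> UNIV \<times> tangent_space N p" by (simp add: mem_Times_iff)
next
  fix x :: "'a \<times> 'b" assume "x \<in> UNIV \<times> tangent_space N p"
  then obtain a v where x: "x = (a, v)" and "v \<in> tangent_space N p" by auto
  then obtain \<gamma> where \<gamma>: "\<And>t. \<gamma> t \<in> N" "\<gamma> 0 = p" "(\<gamma> has_vector_derivative v) (at (0::real))"
    unfolding tangent_space_def by blast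
  obtain \<epsilon> where \<epsilon>: "\<epsilon> > 0" "cball z \<epsilon> \<subseteq> A"
    using assms open_contains_cball by blast
  define c where "c = (norm a + 1) / \<epsilon>"
  have c: "c > 0" using \<epsilon>(1) by (simp add: c_def add_nonneg_pos)
  have "norm ((sin (c * t) / c) *\<^sub>R a) \<le> \<epsilon>" for t
  proof -
    have "norm ((sin (c * t) / c) *\<^sub>R a) = \<bar>sin (c * t)\<bar> * (norm a / c)"
      using c by simp
    also have "\<dots> \<le> 1 * (norm a / c)"
      using c by (intro mult_right_mono) auto
    also have "\<dots> \<le> \<epsilon>"
      using \<epsilon>(1) by (simp add: c_def divide_simps add_nonneg_pos)
    finally show ?thesis .
  qed
  then have in_A: "z + (sin (c * t) / c) *\<^sub>R a \<in> A" for t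
    using \<epsilon>(2) by (auto simp: dist_norm)
  have "((\<lambda>t. z + (sin (c * t) / c) *\<^sub>R a) has_vector_derivative a) (at 0)"
    using c by (auto intro!: derivative_eq_intros)
  from has_vector_derivative_Pair[OF this \<gamma>(3)]
  have "((\<lambda>t. (z + (sin (c * t) / c) *\<^sub>R a, \<gamma> t)) has_vector_derivative x) (at 0)"
    by (simp add: x)
  then show "x \<in> tangent_space (A \<times> N) (z, p)"
    unfolding tangent_space_def using in_A \<gamma>(1,2)
    by (intro CollectI exI[of _ "\<lambda>t. (z + (sin (c * t) / c) *\<^sub>R a, \<gamma> t)"]) auto
qed

section \<open>Quaternions\<close>

lemma inner_qmult_left: "qmult p u \<bullet> qmult p v = (norm p)\<^sup>2 * (u \<bullet> v)"
  unfolding power2_norm_eq_inner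
  by (cases p; cases u; cases v) (simp add: qmult_def inner_complex_def algebra_simps)

definition qcnj :: "quat \<Rightarrow> quat" where
  "qcnj p = (cnj (fst p), - snd p)"

text \<open>
  On the unit sphere the conjugate is the inverse, so left translation by \<open>p\<close> can be undone.
\<close>
lemma qmult_qcnj:
  assumes "p \<in> S3"
  shows "qmult p (qmult (qcnj p) u) = u"
proof -
  have "p \<bullet> p = 1" using assms by (simp add: norm_eq_1)
  moreover have "qmult p (qmult (qcnj p) u) = (p \<bullet> p) *\<^sub>R u"
    by (cases p; cases u) (simp add: qmult_def qcnj_def inner_complex_def complex_eq_iff algebra_simps)
  ultimately show ?thesis by simp
qed

lemma bounded_bilinear_qmult: "bounded_bilinear qmult"
  unfolding bilinear_conv_bounded_bilinear[symmetric] bilinear_def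
  by (auto intro!: linearI simp: qmult_def algebra_simps scaleR_conv_of_real)

lemmas bounded_linear_qmult_left = bounded_bilinear.bounded_linear_left[OF bounded_bilinear_qmult]

abbreviation qone :: quat where "qone \<equiv> (1, 0)"

lemma qmult_one [simp]: "qmult p qone = p"
  by (simp add: qmult_def)

lemma qmult_one_left [simp]: "qmult qone p = p"
  by (simp add: qmult_def)

lemma qone_in_S3: "qone \<in> S3"
  by (simp add: norm_Pair)

lemma qmult_tangent:
  assumes "p \<in> S3"
  shows "p \<bullet> qmult p v = qone \<bullet> v"
  using inner_qmult_left[of p qone v] assms by simp

section \<open>Brackets and exterior derivatives of linear one-forms\<close>

text \<open>
  In Cartan's formula the terms that differentiate the vector fields cancel against the bracket, and
  those that differentiate the coefficients of the form remain; here the coefficients are linear, so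
  each is its own derivative. Used
  for the coframe on the sphere (\<open>L\<close> the identity) and on the product (\<open>L\<close> the second projection), it
  transfers the structure equation from the former to the latter.
\<close>
lemma ext_deriv_1_inner_product_form:
  fixes A L :: "'a::euclidean_space \<Rightarrow> 'b::real_inner"
  assumes lin: "bounded_linear A" "bounded_linear L"
    and \<alpha>: "\<And>q u. q \<in> M \<Longrightarrow> u \<in> tangent_space M q \<Longrightarrow> \<alpha> q u = A q \<bullet> L u"
    and X: "vector_field M X" and Y: "vector_field M Y" and p: "p \<in> M"
    and br: "lie_bracket M X Y p \<in> tangent_space M p"
  shows "ext_deriv_1 M \<alpha> X Y p = A (X p) \<bullet> L (Y p) - A (Y p) \<bullet> L (X p)"
proof -
  have D: "dir_deriv M (\<lambda>q. \<alpha> q (V q)) p v = A p \<bullet> L (dir_deriv M V p v) + A v \<bullet> L (V p)"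
    if V: "vector_field M V" and v: "v \<in> tangent_space M p" for V v
  proof -
    have sm: "smooth_on M V" using V by (simp add: vector_field_def)
    have "dir_deriv M (\<lambda>q. \<alpha> q (V q)) p v = dir_deriv M (\<lambda>q. A q \<bullet> L (V q)) p v"
      using V by (intro dir_deriv_cong p \<alpha>) (auto simp: vector_field_def)
    also have "\<dots> = A p \<bullet> dir_deriv M (\<lambda>q. L (V q)) p v + dir_deriv M A p v \<bullet> L (V p)"
      by (rule dir_deriv_inner[OF smooth_on_bounded_linear[OF lin(1)]
            smooth_on_linear_comp[OF lin(2) sm] p v])
    finally show ?thesis
      by (simp add: dir_deriv_bounded_linear[OF lin(1) v] dir_deriv_linear_comp[OF lin(2) sm p v])
  qed
  have t: "X p \<in> tangent_space M p" "Y p \<in> tangent_space M p"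
    using X Y p by (auto simp: vector_field_def)
  have "\<alpha> p (lie_bracket M X Y p) =
      A p \<bullet> L (dir_deriv M Y p (X p)) - A p \<bullet> L (dir_deriv M X p (Y p))"
    unfolding \<alpha>[OF p br]
    by (simp add: lie_bracket_def linear_diff[OF bounded_linear.linear[OF lin(2)]] inner_diff_right)
  then show ?thesis
    unfolding ext_deriv_1_def D[OF X t(2)] D[OF Y t(1)] by simp
qed

text \<open>
  Differentiating \<open>L q \<bullet> L (Y q) = 0\<close> along \<open>X\<close> gives a term symmetric in \<open>X\<close> and \<open>Y\<close>, which
  cancels in the bracket. This shows that brackets of tangent fields are tangent to spheres.
\<close>
lemma lie_bracket_orthogonal:
  fixes L :: "'a::euclidean_space \<Rightarrow> 'b::real_inner"
  assumes L: "bounded_linear L"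
    and tan: "\<And>q u. q \<in> M \<Longrightarrow> u \<in> tangent_space M q \<Longrightarrow> L q \<bullet> L u = 0"
    and X: "vector_field M X" and Y: "vector_field M Y" and p: "p \<in> M"
  shows "L p \<bullet> L (lie_bracket M X Y p) = 0"
proof -
  have D: "L p \<bullet> L (dir_deriv M V p v) = - (L v \<bullet> L (V p))"
    if V: "vector_field M V" and v: "v \<in> tangent_space M p" for V v
  proof -
    have sm: "smooth_on M V" using V by (simp add: vector_field_def)
    have "0 = dir_deriv M (\<lambda>q. 0 :: real) p v" using v by (simp add: dir_deriv_const)
    also have "\<dots> = dir_deriv M (\<lambda>q. L q \<bullet> L (V q)) p v"
      using V by (intro dir_deriv_cong p) (auto simp: vector_field_def tan)
    also have "\<dots> = L p \<bullet> dir_deriv M (\<lambda>q. L (V q)) p v + dir_deriv M L p v \<bullet> L (V p)"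
      by (rule dir_deriv_inner[OF smooth_on_bounded_linear[OF L] smooth_on_linear_comp[OF L sm] p v])
    finally show ?thesis
      by (simp add: dir_deriv_bounded_linear[OF L v] dir_deriv_linear_comp[OF L sm p v])
  qed
  have t: "X p \<in> tangent_space M p" "Y p \<in> tangent_space M p"
    using X Y p by (auto simp: vector_field_def)
  show ?thesis
    unfolding lie_bracket_def linear_diff[OF bounded_linear.linear[OF L]] inner_diff_right
      D[OF X t(2)] D[OF Y t(1)] by (simp add: inner_commute)
qed

text \<open>
  The functional is only known to be linear on the hyperplane, so the Riesz representation is applied
  after orthogonal projection onto it.
\<close>
lemma linear_functional_on_hyperplane:
  fixes n :: "'a::euclidean_space" and \<phi> :: "'a \<Rightarrow> real"
  assumes "norm n = 1"
    and lin: "\<And>u v a b. n \<bullet> u = 0 \<Longrightarrow> n \<bullet> v = 0 \<Longrightarrow> \<phi> (a *\<^sub>R u + b *\<^sub>R v) = a * \<phi> u + b * \<phi> v"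
  shows "\<exists>w. \<forall>u. n \<bullet> u = 0 \<longrightarrow> \<phi> u = w \<bullet> u"
proof -
  define P where "P u = u - (n \<bullet> u) *\<^sub>R n" for u
  have P: "n \<bullet> P u = 0" for u
    using assms(1) by (simp add: P_def inner_diff_right norm_eq_1)
  have P_add: "P (u + v) = 1 *\<^sub>R P u + 1 *\<^sub>R P v" and P_scale: "P (a *\<^sub>R u) = a *\<^sub>R P u + 0 *\<^sub>R P u" for a u v
    by (simp_all add: P_def algebra_simps)
  have "linear (\<lambda>u. \<phi> (P u))"
    by (rule linearI; unfold P_add P_scale; subst lin[OF P P]) simp_all
  from adjoint_works[OF this]
  have "\<phi> (P u) = adjoint (\<lambda>u. \<phi> (P u)) 1 \<bullet> u" for u
    by (metis inner_commute inner_real_def mult.right_neutral)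
  moreover have "P u = u" if "n \<bullet> u = 0" for u
    using that by (simp add: P_def)
  ultimately show ?thesis by metis
qed

section \<open>Left-invariant coframes on the three-sphere\<close>

lemmas tangent_S3 = tangent_space_sphere[where 'a=quat]

locale invariant_coframe =
  fixes \<eta> :: "3 \<Rightarrow> quat \<Rightarrow> quat \<Rightarrow> real" and e :: "3 \<Rightarrow> quat \<Rightarrow> quat"
  assumes coframe: "left_invariant_coframe \<eta> e"
begin

lemma eta_linear:
  assumes "p \<in> S3" "p \<bullet> u = 0" "p \<bullet> v = 0"
  shows "\<eta> i p (a *\<^sub>R u + b *\<^sub>R v) = a * \<eta> i p u + b * \<eta> i p v"
proof -
  have "linear_on_tangent S3 p (\<eta> i p)"
    using coframe assms(1) unfolding left_invariant_coframe_def one_form_def by blast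
  then show ?thesis
    unfolding linear_on_tangent_def tangent_S3[OF assms(1)] real_scaleR_def using assms(2,3) by blast
qed

lemma e_tangent: "p \<in> S3 \<Longrightarrow> p \<bullet> e i p = 0"
  and eta_e: "p \<in> S3 \<Longrightarrow> \<eta> i p (e j p) = (if i = j then 1 else 0)"
  using coframe by (auto simp: left_invariant_coframe_def dual_frame_def tangent_S3)

definition eta_vec :: "3 \<Rightarrow> quat" where
  "eta_vec i = (SOME w. \<forall>u. qone \<bullet> u = 0 \<longrightarrow> \<eta> i qone u = w \<bullet> u)"

text \<open>
  The values at \<open>1\<close> determine a left-invariant form, and left translation by a unit quaternion is an
  isometry.
\<close>
lemma eta_eq_inner:
  assumes "p \<in> S3" "p \<bullet> u = 0"
  shows "\<eta> i p u = qmult p (eta_vec i) \<bullet> u"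
proof -
  have "\<exists>w. \<forall>u. qone \<bullet> u = 0 \<longrightarrow> \<eta> i qone u = w \<bullet> u"
    using qone_in_S3 by (intro linear_functional_on_hyperplane eta_linear) auto
  from someI_ex[OF this]
  have one: "\<eta> i qone u = eta_vec i \<bullet> u" if "qone \<bullet> u = 0" for u
    using that unfolding eta_vec_def by blast
  define v where "v = qmult (qcnj p) u"
  have pv: "qmult p v = u" using qmult_qcnj[OF assms(1)] by (simp add: v_def)
  then have v: "qone \<bullet> v = 0" using qmult_tangent[OF assms(1), of v] assms(2) by simp
  have "\<eta> i (qmult p qone) (qmult p v) = \<eta> i qone v"
    using coframe assms(1) qone_in_S3 v
    unfolding left_invariant_coframe_def left_invariant_def by (metis (mono_tags) mem_Collect_eq tangent_S3)
  then have "\<eta> i p u = eta_vec i \<bullet> v" using one[OF v] by (simp add: pv)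
  also have "\<dots> = qmult p (eta_vec i) \<bullet> qmult p v"
    using assms(1) by (simp add: inner_qmult_left)
  finally show ?thesis by (simp add: pv)
qed

text \<open>
  The frame is independent by duality, and the tangent space has dimension three, so the frame
  spans it.
\<close>
lemma frame_expansion:
  assumes p: "p \<in> S3" and u: "p \<bullet> u = 0"
  shows "u = \<eta> 1 p u *\<^sub>R e 1 p + \<eta> 2 p u *\<^sub>R e 2 p + \<eta> 3 p u *\<^sub>R e 3 p"
proof -
  let ?E = "range (\<lambda>i. e i p)" and ?T = "{v. p \<bullet> v = 0}"
  let ?w = "\<lambda>i. qmult p (eta_vec i)"
  have w: "?w i \<bullet> e j p = (if i = j then 1 else 0)" for i j
    using eta_eq_inner[OF p e_tangent[OF p]] eta_e[OF p] by metis
  have inj: "inj (\<lambda>i. e i p)"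
    by (rule injI) (metis w zero_neq_one)
  have "independent ?E"
    unfolding independent_explicit_module
  proof (intro allI impI)
    fix t c x assume t: "finite t" "t \<subseteq> ?E" "(\<Sum>v\<in>t. c v *\<^sub>R v) = 0" "x \<in> t"
    then obtain i where i: "x = e i p" by auto
    have "0 = ?w i \<bullet> (\<Sum>v\<in>t. c v *\<^sub>R v)" using t(3) by simp
    also have "\<dots> = (\<Sum>v\<in>t. if v = x then c v else 0)"
      unfolding inner_sum_right
    proof (rule sum.cong[OF refl])
      fix v assume "v \<in> t"
      then obtain j where "v = e j p" using t(2) by auto
      then show "?w i \<bullet> c v *\<^sub>R v = (if v = x then c v else 0)"
        using i w injD[OF inj] by auto
    qed
    also have "\<dots> = c x" using t by simp
    finally show "c x = 0" by simp
  qed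
  moreover have "?E \<subseteq> ?T" using e_tangent[OF p] by auto
  moreover have "card ?E = dim ?T"
  proof -
    have "card ?E = 3" using card_image[OF inj] by simp
    moreover have "dim ?T = DIM(quat) - 1"
      using p by (intro dim_hyperplane) auto
    ultimately show ?thesis by simp
  qed
  ultimately have "?T \<subseteq> span ?E"
    by (intro card_ge_dim_independent) auto
  then have "u \<in> span ?E" using u by auto
  then obtain r where "u = (\<Sum>v\<in>?E. r v *\<^sub>R v)"
    using span_finite[of ?E] by auto
  then have "u = (\<Sum>i\<in>UNIV. r (e i p) *\<^sub>R e i p)"
    by (simp add: sum.reindex[OF inj])
  then have *: "u = r (e 1 p) *\<^sub>R e 1 p + r (e 2 p) *\<^sub>R e 2 p + r (e 3 p) *\<^sub>R e 3 p"
    by (simp add: sum_3)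
  have "\<eta> i p u = r (e i p)" for i
    unfolding eta_eq_inner[OF p u]
    by (subst *) (use exhaust_3[of i] in \<open>auto simp: w inner_add_right\<close>)
  then show ?thesis using * by simp
qed

text \<open>
  Both sides are tangent and dual to the left-invariant coframe, so they agree by the frame
  expansion.
\<close>
lemma e_eq:
  assumes p: "p \<in> S3"
  shows "e i p = qmult p (e i qone)"
proof -
  have t: "p \<bullet> qmult p (e i qone) = 0"
    using qmult_tangent[OF p] e_tangent[OF qone_in_S3] by simp
  have "\<eta> j p (qmult p (e i qone)) = \<eta> j qone (e i qone)" for j
    using p qone_in_S3 by (simp add: eta_eq_inner t e_tangent inner_qmult_left)
  then have "qmult p (e i qone) = \<eta> 1 qone (e i qone) *\<^sub>R e 1 p + \<eta> 2 qone (e i qone) *\<^sub>R e 2 p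
      + \<eta> 3 qone (e i qone) *\<^sub>R e 3 p"
    using frame_expansion[OF p t] by simp
  also have "\<dots> = e i p"
    using exhaust_3[of i] by (auto simp: eta_e[OF qone_in_S3])
  finally show ?thesis by simp
qed

text \<open>
  The structure equation as an identity between tangent vectors at one point. To extract it from
  the hypothesis about vector fields, \<open>u\<close> and \<open>v\<close> are extended to left-invariant fields.
\<close>
lemma eta_structure:
  assumes p: "p \<in> S3" and "p \<bullet> u = 0" "p \<bullet> v = 0"
  shows "qmult u (eta_vec i) \<bullet> v - qmult v (eta_vec i) \<bullet> u =
     - 2 * (\<eta> (i + 1) p u * \<eta> (i + 2) p v - \<eta> (i + 1) p v * \<eta> (i + 2) p u)"
proof -
  have left_field: "\<exists>X. vector_field S3 X \<and> X p = x" if "p \<bullet> x = 0" for x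
  proof (intro exI[of _ "\<lambda>q. qmult q (qmult (qcnj p) x)"] conjI)
    show eq: "qmult p (qmult (qcnj p) x) = x" by (rule qmult_qcnj[OF p])
    have "qone \<bullet> qmult (qcnj p) x = 0"
      using qmult_tangent[OF p, of "qmult (qcnj p) x"] eq that by simp
    then show "vector_field S3 (\<lambda>q. qmult q (qmult (qcnj p) x))"
      by (auto simp: vector_field_def tangent_S3 qmult_tangent
          intro: smooth_on_bounded_linear bounded_linear_qmult_left)
  qed
  obtain X Y where X: "vector_field S3 X" "X p = u" and Y: "vector_field S3 Y" "Y p = v"
    using left_field assms by metis
  have br: "lie_bracket S3 X Y p \<in> tangent_space S3 p"
    using lie_bracket_orthogonal[OF bounded_linear_ident, of S3 X Y p] X Y p
    by (simp add: tangent_S3)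
  have "ext_deriv_1 S3 (\<eta> i) X Y p = qmult u (eta_vec i) \<bullet> v - qmult v (eta_vec i) \<bullet> u"
    using ext_deriv_1_inner_product_form[OF bounded_linear_qmult_left bounded_linear_ident _ X(1) Y(1) p br, of "\<eta> i" "eta_vec i"]
    by (simp add: tangent_S3 eta_eq_inner X(2) Y(2))
  moreover have "ext_deriv_1 S3 (\<eta> i) X Y p = - 2 * wedge (\<eta> (i + 1)) (\<eta> (i + 2)) p u v"
    using coframe X Y p unfolding left_invariant_coframe_def has_ext_deriv_def by blast
  ultimately show ?thesis by (simp add: wedge_def)
qed

end

section \<open>The moving frame on the cylinder\<close>

locale coframe_cylinder = invariant_coframe +
  fixes I :: "real set"
  assumes open_I: "open I"
begin

abbreviation M :: "(real \<times> quat) set" where "M \<equiv> I \<times> S3"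

abbreviation coef :: "3 \<Rightarrow> (real \<times> quat \<Rightarrow> real \<times> quat) \<Rightarrow> real \<times> quat \<Rightarrow> real" where
  "coef i X q \<equiv> \<eta> i (snd q) (snd (X q))"

lemma tangent_M: "q \<in> M \<Longrightarrow> u \<in> tangent_space M q \<longleftrightarrow> snd q \<bullet> snd u = 0"
  using tangent_space_open_Times[OF open_I, of "fst q" S3 "snd q"] tangent_S3[of "snd q"]
  by (cases q; cases u) auto

text \<open>
  A tangent vector is determined by its components, so vector identities reduce to four scalar ones.
\<close>
lemma tangent_M_ext:
  assumes "q \<in> M" "u \<in> tangent_space M q" "v \<in> tangent_space M q"
    and "fst u = fst v" "\<eta> 1 (snd q) (snd u) = \<eta> 1 (snd q) (snd v)"
      "\<eta> 2 (snd q) (snd u) = \<eta> 2 (snd q) (snd v)" "\<eta> 3 (snd q) (snd u) = \<eta> 3 (snd q) (snd v)"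
  shows "u = v"
proof (rule prod_eqI)
  have q: "snd q \<in> S3" using assms(1) by auto
  have "snd q \<bullet> snd u = 0" "snd q \<bullet> snd v = 0" using assms(1-3) by (simp_all add: tangent_M)
  from frame_expansion[OF q this(1)] frame_expansion[OF q this(2)] assms(5-7)
  show "snd u = snd v" by simp
qed (rule assms(4))

lemma tangent_M_diff:
  "q \<in> M \<Longrightarrow> u \<in> tangent_space M q \<Longrightarrow> v \<in> tangent_space M q \<Longrightarrow> u - v \<in> tangent_space M q"
  by (simp add: tangent_M inner_diff_right)

lemma eta_snd_linear:
  assumes "q \<in> M" "u \<in> tangent_space M q" "v \<in> tangent_space M q"
  shows "\<eta> i (snd q) (a *\<^sub>R snd u + b *\<^sub>R snd v) = a * \<eta> i (snd q) (snd u) + b * \<eta> i (snd q) (snd v)"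
  using assms by (intro eta_linear) (auto simp: tangent_M)

lemma eta_snd_diff:
  assumes "q \<in> M" "u \<in> tangent_space M q" "v \<in> tangent_space M q"
  shows "\<eta> i (snd q) (snd (u - v)) = \<eta> i (snd q) (snd u) - \<eta> i (snd q) (snd v)"
  using eta_snd_linear[OF assms, of i 1 "-1"] by simp

lemma field_smooth: "vector_field M X \<Longrightarrow> smooth_on M X"
  and field_tangent: "vector_field M X \<Longrightarrow> q \<in> M \<Longrightarrow> X q \<in> tangent_space M q"
  by (auto simp: vector_field_def)

lemma smooth_fst: "vector_field M X \<Longrightarrow> smooth_on M (\<lambda>q. fst (X q))"
  by (rule smooth_on_fst[OF field_smooth])

lemma bounded_linear_qmult_snd: "bounded_linear (\<lambda>q. qmult (snd q) c)"
  by (rule bounded_linear_compose[OF bounded_linear_qmult_left bounded_linear_snd])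

lemma smooth_coef:
  assumes "vector_field M X"
  shows "smooth_on M (coef i X)"
proof (rule smooth_on_cong)
  show "smooth_on M (\<lambda>q. qmult (snd q) (eta_vec i) \<bullet> snd (X q))"
    by (rule smooth_on_inner[OF smooth_on_bounded_linear[OF bounded_linear_qmult_snd]
          smooth_on_snd[OF field_smooth[OF assms]]])
  show "qmult (snd q) (eta_vec i) \<bullet> snd (X q) = coef i X q" if "q \<in> M" for q
    using field_tangent[OF assms that] that by (auto simp: tangent_M eta_eq_inner)
qed

lemma frame_combination:
  assumes "q \<in> M" "snd u = a *\<^sub>R e 1 (snd q) + b *\<^sub>R e 2 (snd q) + c *\<^sub>R e 3 (snd q)"
  shows "u \<in> tangent_space M q"
    and "\<eta> 1 (snd q) (snd u) = a" "\<eta> 2 (snd q) (snd u) = b" "\<eta> 3 (snd q) (snd u) = c"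
proof -
  have q: "snd q \<in> S3" using assms(1) by auto
  have t: "snd q \<bullet> snd u = 0" using assms(2) by (simp add: inner_add_right e_tangent[OF q])
  show "u \<in> tangent_space M q" by (simp add: tangent_M[OF assms(1)] t)
  have "\<eta> i (snd q) (snd u) = a * \<eta> i (snd q) (e 1 (snd q)) + b * \<eta> i (snd q) (e 2 (snd q))
     + c * \<eta> i (snd q) (e 3 (snd q))" for i
    unfolding eta_eq_inner[OF q t] eta_eq_inner[OF q e_tangent[OF q]]
    by (simp add: assms(2) inner_add_right)
  then show "\<eta> 1 (snd q) (snd u) = a" "\<eta> 2 (snd q) (snd u) = b" "\<eta> 3 (snd q) (snd u) = c"
    by (simp_all add: eta_e[OF q])
qed

lemma vector_field_frame_combination:
  assumes "smooth_on M x0" "smooth_on M x1" "smooth_on M x2" "smooth_on M x3"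
  shows "vector_field M (\<lambda>q. (x0 q, x1 q *\<^sub>R e 1 (snd q) + x2 q *\<^sub>R e 2 (snd q) + x3 q *\<^sub>R e 3 (snd q)))"
proof -
  have e: "smooth_on M (\<lambda>q. e i (snd q))" for i
    by (rule smooth_on_cong[OF smooth_on_bounded_linear[OF bounded_linear_qmult_snd[of "e i qone"]]])
      (auto simp: e_eq[symmetric])
  show ?thesis
    unfolding vector_field_def
    using smooth_on_Pair[OF assms(1) smooth_on_add[OF smooth_on_add[OF
          smooth_on_scaleR[OF assms(2) e] smooth_on_scaleR[OF assms(3) e]]
          smooth_on_scaleR[OF assms(4) e]]]
    by (auto intro: frame_combination(1))
qed

lemma bracket_tangent:
  assumes "vector_field M X" "vector_field M Y" "q \<in> M"
  shows "lie_bracket M X Y q \<in> tangent_space M q"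
  using lie_bracket_orthogonal[OF bounded_linear_snd _ assms] assms(3)
  by (simp add: tangent_M)

lemma fst_bracket:
  assumes "vector_field M X" "vector_field M Y" "q \<in> M"
  shows "fst (lie_bracket M X Y q) =
    dir_deriv M (\<lambda>q. fst (Y q)) q (X q) - dir_deriv M (\<lambda>q. fst (X q)) q (Y q)"
  using assms by (simp add: lie_bracket_def dir_deriv_fst field_smooth field_tangent)

text \<open>
  Cartan's formula on the cylinder. The components in the frame turn brackets of arbitrary vector
  fields into derivatives of scalar functions.
\<close>
lemma eta_bracket:
  assumes X: "vector_field M X" and Y: "vector_field M Y" and q: "q \<in> M"
  shows "\<eta> i (snd q) (snd (lie_bracket M X Y q)) =
    dir_deriv M (coef i Y) q (X q) - dir_deriv M (coef i X) q (Y q)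
    + 2 * (coef (i + 1) X q * coef (i + 2) Y q - coef (i + 1) Y q * coef (i + 2) X q)"
proof -
  let ?\<alpha> = "\<lambda>q u. \<eta> i (snd q) (snd u)"
  have "ext_deriv_1 M ?\<alpha> X Y q =
      qmult (snd (X q)) (eta_vec i) \<bullet> snd (Y q) - qmult (snd (Y q)) (eta_vec i) \<bullet> snd (X q)"
    by (rule ext_deriv_1_inner_product_form[OF bounded_linear_qmult_snd bounded_linear_snd _ X Y q
          bracket_tangent[OF X Y q]]) (auto simp: tangent_M eta_eq_inner)
  also have "\<dots> = - 2 * (coef (i + 1) X q * coef (i + 2) Y q - coef (i + 1) Y q * coef (i + 2) X q)"
    using field_tangent[OF X q] field_tangent[OF Y q] q
    by (intro eta_structure) (auto simp: tangent_M)
  finally show ?thesis by (simp add: ext_deriv_1_def)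
qed

lemma index_arith: "(1::3) + 1 = 2" "(1::3) + 2 = 3" "(2::3) + 1 = 3" "(2::3) + 2 = 1"
    "(3::3) + 1 = 1" "(3::3) + 2 = 2"
  by simp_all

lemmas eta_bracket_1 = eta_bracket[of _ _ _ 1, unfolded index_arith]
  and eta_bracket_2 = eta_bracket[of _ _ _ 2, unfolded index_arith]
  and eta_bracket_3 = eta_bracket[of _ _ _ 3, unfolded index_arith]

end

section \<open>The complex structures\<close>

lemma smooth_on_open_DERIV:
  fixes f :: "real \<Rightarrow> real"
  assumes "open A" "smooth_on A f" "z \<in> A"
  shows "(f has_real_derivative deriv f z) (at z)"
proof -
  obtain f' where "(f has_derivative f') (at z within A)"
    using smooth_on_imp_has_derivative assms(2,3) by blast
  then have "(f has_derivative f') (at z)"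
    by (simp only: at_within_open[OF assms(3,1)])
  then have "f differentiable (at z)" by (rule differentiableI)
  then show ?thesis by (simp add: DERIV_deriv_iff_real_differentiable)
qed

text \<open>
  Both complex structures are treated at once; the sign \<open>s\<close> enters the computations through
  \<open>s\<^sup>2 = 1\<close>.
\<close>
locale hermitian_cylinder = coframe_cylinder +
  fixes F :: "real \<Rightarrow> real" and s :: real
  assumes smooth_F: "smooth_on I F" and F_pos: "\<And>z. z \<in> I \<Longrightarrow> F z > 0"
    and s_sq: "s * s = 1"
begin

abbreviation J :: "real \<times> quat \<Rightarrow> real \<times> quat \<Rightarrow> real \<times> quat" where
  "J \<equiv> complex_J \<eta> e F s"

text \<open>
  With the reciprocal as a symbol of its own, subject to \<open>2 F h = 1\<close>, all component formulas are
  polynomial, and the identities below are within reach of \<open>algebra\<close>.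
\<close>
definition h :: "real \<Rightarrow> real" where "h z = 1 / (2 * F z)"

lemma fst_J: "fst (J q u) = - (2 * s * F (fst q)) * \<eta> 1 (snd q) (snd u)"
  by (cases q; cases u) (simp add: complex_J_def)

lemma snd_J: "snd (J q u) = (s * h (fst q) * fst u) *\<^sub>R e 1 (snd q)
    + (- \<eta> 3 (snd q) (snd u)) *\<^sub>R e 2 (snd q) + \<eta> 2 (snd q) (snd u) *\<^sub>R e 3 (snd q)"
  by (cases q; cases u) (simp add: complex_J_def h_def)

lemmas J_tangent = frame_combination(1)[OF _ snd_J]
  and eta_J = frame_combination(2-4)[OF _ snd_J]

lemma F_h:
  assumes "q \<in> M"
  shows "2 * F (fst q) * h (fst q) = 1"
proof -
  have "2 * F (fst q) \<noteq> 0" using F_pos[of "fst q"] assms by auto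
  then show ?thesis by (simp add: h_def)
qed

lemma DERIV_F: "z \<in> I \<Longrightarrow> (F has_real_derivative deriv F z) (at z)"
  by (rule smooth_on_open_DERIV[OF open_I smooth_F])

lemma DERIV_h:
  assumes "z \<in> I"
  shows "(h has_real_derivative - 2 * deriv F z * h z * h z) (at z)"
  unfolding h_def using F_pos[OF assms] DERIV_F[OF assms]
  by (auto intro!: derivative_eq_intros simp: field_simps)

lemma smooth_F_fst: "smooth_on M (\<lambda>q. F (fst q))"
  by (rule smooth_on_comp_fst[OF smooth_F])

lemma smooth_h_fst: "smooth_on M (\<lambda>q. h (fst q))"
proof -
  have "smooth_on M (\<lambda>q. inverse (2 * F (fst q)))"
  proof (rule smooth_on_inverse[OF smooth_on_mult[OF smooth_on_const smooth_F_fst]])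
    show "2 * F (fst q) \<noteq> 0" if "q \<in> M" for q using F_pos[of "fst q"] that by auto
  qed
  then show ?thesis by (simp only: h_def inverse_eq_divide)
qed

lemma vector_field_J:
  assumes X: "vector_field M X"
  shows "vector_field M (\<lambda>q. J q (X q))"
proof -
  have "(\<lambda>q. J q (X q)) = (\<lambda>q. (- (2 * s * F (fst q)) * coef 1 X q,
      (s * h (fst q) * fst (X q)) *\<^sub>R e 1 (snd q)
      + (- coef 3 X q) *\<^sub>R e 2 (snd q) + coef 2 X q *\<^sub>R e 3 (snd q)))"
    by (rule ext, rule prod_eqI) (simp_all add: fst_J snd_J)
  moreover have "vector_field M \<dots>"
    by (intro vector_field_frame_combination smooth_on_mult smooth_on_minus smooth_coef[OF X]
        smooth_fst[OF X] smooth_on_const smooth_F_fst smooth_h_fst)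
  ultimately show ?thesis by simp
qed

lemma J_J:
  assumes q: "q \<in> M" and u: "u \<in> tangent_space M q"
  shows "J q (J q u) = - u"
proof (rule tangent_M_ext[OF q J_tangent[OF q]])
  show t: "- u \<in> tangent_space M q" using u by (simp add: tangent_M[OF q])
  show "fst (J q (J q u)) = fst (- u)"
    using F_h[OF q] s_sq by (simp only: fst_J eta_J[OF q]) (simp, algebra)
  have m: "\<eta> i (snd q) (snd (- u)) = - \<eta> i (snd q) (snd u)" for i
    using eta_snd_linear[OF q u u, of i "-1" 0] by simp
  show "\<eta> 1 (snd q) (snd (J q (J q u))) = \<eta> 1 (snd q) (snd (- u))"
    unfolding m eta_J[OF q] fst_J using F_h[OF q] s_sq by algebra
  show "\<eta> 2 (snd q) (snd (J q (J q u))) = \<eta> 2 (snd q) (snd (- u))"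
    unfolding m eta_J[OF q] ..
  show "\<eta> 3 (snd q) (snd (J q (J q u))) = \<eta> 3 (snd q) (snd (- u))"
    unfolding m eta_J[OF q] ..
qed

lemma J_linear:
  assumes q: "q \<in> M" and u: "u \<in> tangent_space M q" and v: "v \<in> tangent_space M q"
  shows "J q (a *\<^sub>R u + b *\<^sub>R v) = a *\<^sub>R J q u + b *\<^sub>R J q v"
  by (rule prod_eqI) (simp_all add: fst_J snd_J eta_snd_linear[OF q u v] algebra_simps)

lemma almost_complex_J: "almost_complex_structure M J"
  unfolding almost_complex_structure_def linear_on_tangent_def
proof (intro conjI ballI allI impI)
  show "smooth_on M (\<lambda>q. J q (X q))" if "vector_field M X" for X
    by (rule field_smooth[OF vector_field_J[OF that]])
qed (rule J_linear J_tangent J_J, assumption+)+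

lemma dir_deriv_fst_J:
  assumes X: "vector_field M X" and q: "q \<in> M" and v: "v \<in> tangent_space M q"
  shows "dir_deriv M (\<lambda>q. fst (J q (X q))) q v =
    - 2 * s * (F (fst q) * dir_deriv M (coef 1 X) q v + deriv F (fst q) * fst v * coef 1 X q)"
proof -
  have "((\<lambda>z. - (2 * s * F z)) has_real_derivative - (2 * s * deriv F (fst q))) (at (fst q))"
    using q by (auto intro!: derivative_eq_intros DERIV_F)
  note d = dir_deriv_comp_fst[OF this v]
  have "dir_deriv M (\<lambda>q. - (2 * s * F (fst q)) * coef 1 X q) q v =
      - (2 * s * F (fst q)) * dir_deriv M (coef 1 X) q v
      + dir_deriv M (\<lambda>q. - (2 * s * F (fst q))) q v * coef 1 X q"
    by (intro dir_deriv_mult smooth_on_minus smooth_on_mult smooth_on_const smooth_F_fst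
        smooth_coef X q v)
  then show ?thesis
    unfolding fst_J d by (simp add: algebra_simps)
qed

lemma dir_deriv_coef_J:
  assumes X: "vector_field M X" and q: "q \<in> M" and v: "v \<in> tangent_space M q"
  shows "dir_deriv M (coef 1 (\<lambda>q. J q (X q))) q v =
      s * h (fst q) * dir_deriv M (\<lambda>q. fst (X q)) q v
      - 2 * s * deriv F (fst q) * h (fst q) * h (fst q) * fst v * fst (X q)"
    and "dir_deriv M (coef 2 (\<lambda>q. J q (X q))) q v = - dir_deriv M (coef 3 X) q v"
    and "dir_deriv M (coef 3 (\<lambda>q. J q (X q))) q v = dir_deriv M (coef 2 X) q v"
proof -
  have "((\<lambda>z. s * h z) has_real_derivative s * (- 2 * deriv F (fst q) * h (fst q) * h (fst q))) (at (fst q))"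
    using q by (intro DERIV_cmult DERIV_h) auto
  note d = dir_deriv_comp_fst[OF this v]
  have "dir_deriv M (coef 1 (\<lambda>q. J q (X q))) q v = dir_deriv M (\<lambda>q. s * h (fst q) * fst (X q)) q v"
    by (rule dir_deriv_cong[OF _ q]) (rule eta_J)
  also have "\<dots> = s * h (fst q) * dir_deriv M (\<lambda>q. fst (X q)) q v
      + dir_deriv M (\<lambda>q. s * h (fst q)) q v * fst (X q)"
    by (rule dir_deriv_mult[OF smooth_on_mult[OF smooth_on_const smooth_h_fst] smooth_fst[OF X] q v])
  finally show "dir_deriv M (coef 1 (\<lambda>q. J q (X q))) q v =
      s * h (fst q) * dir_deriv M (\<lambda>q. fst (X q)) q v
      - 2 * s * deriv F (fst q) * h (fst q) * h (fst q) * fst v * fst (X q)"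
    unfolding d by simp
  have "dir_deriv M (coef 2 (\<lambda>q. J q (X q))) q v = dir_deriv M (\<lambda>q. - coef 3 X q) q v"
    by (rule dir_deriv_cong[OF _ q]) (rule eta_J)
  also have "\<dots> = - dir_deriv M (coef 3 X) q v"
    by (rule dir_deriv_minus[OF smooth_coef[OF X] q v])
  finally show "dir_deriv M (coef 2 (\<lambda>q. J q (X q))) q v = - dir_deriv M (coef 3 X) q v" .
  show "dir_deriv M (coef 3 (\<lambda>q. J q (X q))) q v = dir_deriv M (coef 2 X) q v"
    by (rule dir_deriv_cong[OF _ q]) (rule eta_J)
qed

text \<open>
  In each component the derivatives of the components of \<open>X\<close> and \<open>Y\<close> cancel, and so do the terms
  with the derivative of \<open>F\<close>. So \<open>N\<close> is a tensor, with \<open>N(J X, Y) = - J N(X, Y)\<close>; hence it vanishes on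
  \<open>J\<close>-invariant planes, and only \<open>N(\<partial>/\<partial>z, e\<^sub>2)\<close> matters. This is zero because \<open>J\<close> maps \<open>\<partial>/\<partial>z\<close> to a
  multiple of \<open>e\<^sub>1\<close>, and \<open>[e\<^sub>1, \<cdot>]\<close> acts on the plane of \<open>e\<^sub>2\<close> and \<open>e\<^sub>3\<close> as twice a rotation by a right
  angle, which commutes with \<open>J\<close> there.
\<close>
lemma nijenhuis_J:
  assumes X: "vector_field M X" and Y: "vector_field M Y" and q: "q \<in> M"
  shows "nijenhuis M J X Y q = 0"
proof -
  note JX = vector_field_J[OF X] and JY = vector_field_J[OF Y]
  define L1 L2 L3 L4 where
    "L1 = lie_bracket M (\<lambda>q. J q (X q)) (\<lambda>q. J q (Y q)) q" and
    "L2 = lie_bracket M (\<lambda>q. J q (X q)) Y q" and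
    "L3 = lie_bracket M X (\<lambda>q. J q (Y q)) q" and
    "L4 = lie_bracket M X Y q"
  note L_def = L1_def L2_def L3_def L4_def
  have N: "nijenhuis M J X Y q = L1 - J q L2 - J q L3 - L4"
    by (simp add: nijenhuis_def L_def)
  have L: "L1 \<in> tangent_space M q" "L4 \<in> tangent_space M q"
    by (simp_all add: L_def bracket_tangent[OF _ _ q] X Y JX JY)
  note t = L J_tangent[OF q] tangent_M_diff[OF q]
  note expand = fst_bracket[OF _ _ q] eta_bracket_1[OF _ _ q] eta_bracket_2[OF _ _ q]
    eta_bracket_3[OF _ _ q] X Y JX JY dir_deriv_fst_J[OF X q] dir_deriv_fst_J[OF Y q]
    dir_deriv_coef_J[OF X q] dir_deriv_coef_J[OF Y q]
    field_tangent[OF X q] field_tangent[OF Y q] field_tangent[OF JX q] field_tangent[OF JY q]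
  note rel = F_h[OF q] s_sq
  have eta_N: "\<eta> i (snd q) (snd (nijenhuis M J X Y q)) =
    \<eta> i (snd q) (snd L1) - \<eta> i (snd q) (snd (J q L2)) - \<eta> i (snd q) (snd (J q L3)) - \<eta> i (snd q) (snd L4)" for i
    by (simp only: N eta_snd_diff[OF q] t)
  \<comment> \<open>Values of \<open>J\<close> are rewritten last: under \<open>dir_deriv\<close> the fields \<open>J X\<close> and \<open>J Y\<close> have to stay intact
    until the product rule for their components has been applied.\<close>
  have "fst (nijenhuis M J X Y q) = 0"
    unfolding N using rel
    by (simp only: fst_diff fst_J, simp only: L_def expand, simp only: fst_J eta_J[OF q]) algebra
  moreover have "\<eta> 1 (snd q) (snd (nijenhuis M J X Y q)) = 0"
    unfolding eta_N using rel
    by (simp only: eta_J[OF q], simp only: L_def expand, simp only: fst_J eta_J[OF q]) algebra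
  moreover have "\<eta> 2 (snd q) (snd (nijenhuis M J X Y q)) = 0"
    unfolding eta_N
    by (simp only: eta_J[OF q], simp only: L_def expand, simp only: fst_J eta_J[OF q])
      (simp add: algebra_simps)
  moreover have "\<eta> 3 (snd q) (snd (nijenhuis M J X Y q)) = 0"
    unfolding eta_N
    by (simp only: eta_J[OF q], simp only: L_def expand, simp only: fst_J eta_J[OF q])
      (simp add: algebra_simps)
  moreover have "nijenhuis M J X Y q \<in> tangent_space M q"
    unfolding N by (intro t)
  moreover have "0 \<in> tangent_space M q" by (simp add: tangent_M[OF q])
  moreover have "\<eta> i (snd q) (snd 0) = 0" for i
    using eta_snd_linear[OF q L(1) L(1), of i 0 0] by simp
  ultimately show ?thesis
    by (intro tangent_M_ext[OF q]) simp_all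
qed

lemma complex_structure_J: "complex_structure M J"
  unfolding complex_structure_def using almost_complex_J nijenhuis_J by blast

section \<open>The metric and the fundamental form\<close>

lemma metric_g_eq: "metric_g \<eta> F C q u v = C (fst q) * (h (fst q) / 2 * (fst u * fst v)
    + F (fst q) * (\<eta> 1 (snd q) (snd u) * \<eta> 1 (snd q) (snd v))
    + \<eta> 2 (snd q) (snd u) * \<eta> 2 (snd q) (snd v) + \<eta> 3 (snd q) (snd u) * \<eta> 3 (snd q) (snd v))"
  by (cases q; cases u; cases v) (simp add: metric_g_def h_def)

lemma compatible_J: "compatible M (metric_g \<eta> F C) J"
  unfolding compatible_def
proof (intro ballI)
  fix q u v assume q: "q \<in> M"
  show "metric_g \<eta> F C q (J q u) (J q v) = metric_g \<eta> F C q u v"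
    unfolding metric_g_eq fst_J eta_J[OF q] using F_h[OF q] s_sq by algebra
qed

abbreviation \<omega> :: "(real \<Rightarrow> real) \<Rightarrow> real \<times> quat \<Rightarrow> real \<times> quat \<Rightarrow> real \<times> quat \<Rightarrow> real" where
  "\<omega> C \<equiv> fundamental_form (metric_g \<eta> F C) J"

text \<open>
  This is \<open>\<omega> = C ((s/2) dz \<and> \<eta>\<^sup>1 + \<eta>\<^sup>2 \<and> \<eta>\<^sup>3)\<close>; the function \<open>F\<close> cancels.
\<close>
lemma fundamental_form_eq:
  assumes q: "q \<in> M"
  shows "\<omega> C q u v = C (fst q) *
    (s / 2 * (fst u * \<eta> 1 (snd q) (snd v) - \<eta> 1 (snd q) (snd u) * fst v)
     + (\<eta> 2 (snd q) (snd u) * \<eta> 3 (snd q) (snd v) - \<eta> 3 (snd q) (snd u) * \<eta> 2 (snd q) (snd v)))"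
  unfolding fundamental_form_def metric_g_eq fst_J eta_J[OF q] using F_h[OF q] by algebra

lemma fundamental_form_J_invariant:
  assumes q: "q \<in> M"
  shows "\<omega> C q (J q u) (J q v) = \<omega> C q u v"
  unfolding fundamental_form_eq[OF q] fst_J eta_J[OF q] using F_h[OF q] s_sq by algebra

lemma smooth_pairing:
  assumes X: "vector_field M X" and Y: "vector_field M Y"
  shows "smooth_on M (\<lambda>q. s / 2 * (fst (X q) * coef 1 Y q - coef 1 X q * fst (Y q))
     + (coef 2 X q * coef 3 Y q - coef 3 X q * coef 2 Y q))"
  by (intro smooth_on_add smooth_on_diff smooth_on_mult[of M "\<lambda>q. s / 2", OF smooth_on_const]
      smooth_on_mult[OF smooth_fst smooth_coef] smooth_on_mult[OF smooth_coef smooth_fst]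
      smooth_on_mult[OF smooth_coef smooth_coef] X Y)

lemma two_form_fundamental:
  assumes C: "smooth_on I C"
  shows "two_form M (\<omega> C)"
  unfolding two_form_def linear_on_tangent_def
proof (intro conjI ballI allI impI; (elim conjE)?)
  fix q u v w a b assume q: "q \<in> M" and t: "v \<in> tangent_space M q" "w \<in> tangent_space M q"
  show "\<omega> C q u (a *\<^sub>R v + b *\<^sub>R w) = a *\<^sub>R \<omega> C q u v + b *\<^sub>R \<omega> C q u w"
    by (simp add: fundamental_form_eq[OF q] eta_snd_linear[OF q t] algebra_simps)
next
  fix q u v assume q: "q \<in> M"
  show "\<omega> C q u v = - \<omega> C q v u"
    by (simp add: fundamental_form_eq[OF q] algebra_simps)
next
  fix X Y assume "vector_field M X" "vector_field M Y"
  from smooth_on_mult[OF smooth_on_comp_fst[OF C] smooth_pairing[OF this]]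
  show "smooth_on M (\<lambda>q. \<omega> C q (X q) (Y q))"
    by (rule smooth_on_cong) (simp add: fundamental_form_eq)
qed

lemma one_one_form_fundamental:
  assumes C: "smooth_on I C"
  shows "one_one_form M J (\<omega> C)"
  unfolding one_one_form_def using two_form_fundamental[OF C] fundamental_form_J_invariant by blast

lemma dir_deriv_fundamental:
  assumes C: "smooth_on I C" and X: "vector_field M X" and Y: "vector_field M Y"
    and q: "q \<in> M" and v: "v \<in> tangent_space M q"
  shows "dir_deriv M (\<lambda>q. \<omega> C q (X q) (Y q)) q v =
    deriv C (fst q) * fst v * (s / 2 * (fst (X q) * coef 1 Y q - coef 1 X q * fst (Y q))
     + (coef 2 X q * coef 3 Y q - coef 3 X q * coef 2 Y q))
    + C (fst q) * (s / 2 *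
       (fst (X q) * dir_deriv M (coef 1 Y) q v + dir_deriv M (\<lambda>q. fst (X q)) q v * coef 1 Y q
        - (coef 1 X q * dir_deriv M (\<lambda>q. fst (Y q)) q v + dir_deriv M (coef 1 X) q v * fst (Y q)))
     + (coef 2 X q * dir_deriv M (coef 3 Y) q v + dir_deriv M (coef 2 X) q v * coef 3 Y q
        - (coef 3 X q * dir_deriv M (coef 2 Y) q v + dir_deriv M (coef 3 X) q v * coef 2 Y q)))"
proof -
  let ?B = "\<lambda>q. s / 2 * (fst (X q) * coef 1 Y q - coef 1 X q * fst (Y q))
     + (coef 2 X q * coef 3 Y q - coef 3 X q * coef 2 Y q)"
  note sm = smooth_on_mult[OF smooth_fst[OF X] smooth_coef[OF Y]]
    smooth_on_mult[OF smooth_coef[OF X] smooth_fst[OF Y]]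
    smooth_on_mult[OF smooth_coef[OF X] smooth_coef[OF Y]]
  have "(C has_real_derivative deriv C (fst q)) (at (fst q))"
    using q by (intro smooth_on_open_DERIV[OF open_I C]) auto
  note dC = dir_deriv_comp_fst[OF this v]
  have "dir_deriv M (\<lambda>q. \<omega> C q (X q) (Y q)) q v = dir_deriv M (\<lambda>q. C (fst q) * ?B q) q v"
    by (rule dir_deriv_cong[OF _ q]) (rule fundamental_form_eq)
  also have "\<dots> = C (fst q) * dir_deriv M ?B q v + dir_deriv M (\<lambda>q. C (fst q)) q v * ?B q"
    by (rule dir_deriv_mult[OF smooth_on_comp_fst[OF C] smooth_pairing[OF X Y] q v])
  also have "dir_deriv M ?B q v =
      dir_deriv M (\<lambda>q. s / 2 * (fst (X q) * coef 1 Y q - coef 1 X q * fst (Y q))) q v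
      + dir_deriv M (\<lambda>q. coef 2 X q * coef 3 Y q - coef 3 X q * coef 2 Y q) q v"
    by (rule dir_deriv_add[OF smooth_on_mult[OF smooth_on_const smooth_on_diff] smooth_on_diff q v])
      (rule sm)+
  also have "dir_deriv M (\<lambda>q. s / 2 * (fst (X q) * coef 1 Y q - coef 1 X q * fst (Y q))) q v =
      s / 2 * dir_deriv M (\<lambda>q. fst (X q) * coef 1 Y q - coef 1 X q * fst (Y q)) q v"
    by (rule dir_deriv_linear_comp[OF bounded_linear_mult_right smooth_on_diff q v]) (rule sm)+
  also have "dir_deriv M (\<lambda>q. fst (X q) * coef 1 Y q - coef 1 X q * fst (Y q)) q v =
      dir_deriv M (\<lambda>q. fst (X q) * coef 1 Y q) q v - dir_deriv M (\<lambda>q. coef 1 X q * fst (Y q)) q v"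
    by (rule dir_deriv_diff[OF _ _ q v]) (rule sm)+
  also have "dir_deriv M (\<lambda>q. coef 2 X q * coef 3 Y q - coef 3 X q * coef 2 Y q) q v =
      dir_deriv M (\<lambda>q. coef 2 X q * coef 3 Y q) q v - dir_deriv M (\<lambda>q. coef 3 X q * coef 2 Y q) q v"
    by (rule dir_deriv_diff[OF _ _ q v]) (rule sm)+
  finally show ?thesis
    unfolding dC dir_deriv_mult[OF smooth_fst[OF X] smooth_coef[OF Y] q v]
      dir_deriv_mult[OF smooth_coef[OF X] smooth_fst[OF Y] q v]
      dir_deriv_mult[OF smooth_coef[OF X] smooth_coef[OF Y] q v] by simp
qed

text \<open>
  The second factor is \<open>dz \<and> \<eta>\<^sup>2 \<and> \<eta>\<^sup>3\<close>. The term \<open>s C\<close> is \<open>-(s/2) C dz \<and> d\<eta>\<^sup>1\<close>, and \<open>\<eta>\<^sup>2 \<and> \<eta>\<^sup>3\<close> is closed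
  by the structure equations.
\<close>
lemma ext_deriv_fundamental:
  assumes C: "smooth_on I C"
    and X: "vector_field M X" and Y: "vector_field M Y" and Z: "vector_field M Z" and q: "q \<in> M"
  shows "ext_deriv_2 M (\<omega> C) X Y Z q = (deriv C (fst q) + s * C (fst q)) *
    (fst (X q) * (coef 2 Y q * coef 3 Z q - coef 3 Y q * coef 2 Z q)
     - fst (Y q) * (coef 2 X q * coef 3 Z q - coef 3 X q * coef 2 Z q)
     + fst (Z q) * (coef 2 X q * coef 3 Y q - coef 3 X q * coef 2 Y q))"
proof -
  note t = field_tangent[OF X q] field_tangent[OF Y q] field_tangent[OF Z q]
  show ?thesis
    unfolding ext_deriv_2_def fundamental_form_eq[OF q, of C "lie_bracket M V W q" for V W]
      dir_deriv_fundamental[OF C Y Z q t(1)] dir_deriv_fundamental[OF C X Z q t(2)]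
      dir_deriv_fundamental[OF C X Y q t(3)]
      fst_bracket[OF X Y q] fst_bracket[OF X Z q] fst_bracket[OF Y Z q]
      eta_bracket_1[OF X Y q] eta_bracket_1[OF X Z q] eta_bracket_1[OF Y Z q]
      eta_bracket_2[OF X Y q] eta_bracket_2[OF X Z q] eta_bracket_2[OF Y Z q]
      eta_bracket_3[OF X Y q] eta_bracket_3[OF X Z q] eta_bracket_3[OF Y Z q]
    by (simp add: field_simps)
qed

text \<open>
  The fields \<open>\<partial>/\<partial>z\<close>, \<open>e\<^sub>2\<close> and \<open>e\<^sub>3\<close> detect the coefficient of \<open>d\<omega>\<close>; the point \<open>1\<close> of the sphere
  suffices.
\<close>
lemma closed_fundamental_iff_ode:
  assumes C: "smooth_on I C"
  shows "closed_form M (\<omega> C) \<longleftrightarrow> (\<forall>z\<in>I. deriv C z + s * C z = 0)"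
proof
  assume closed: "closed_form M (\<omega> C)"
  show "\<forall>z\<in>I. deriv C z + s * C z = 0"
  proof
    fix z assume z: "z \<in> I"
    have q: "(z, qone) \<in> M" using z qone_in_S3 by simp
    let ?V = "\<lambda>a b c q. (a, 0 *\<^sub>R e 1 (snd q) + b *\<^sub>R e 2 (snd q) + c *\<^sub>R e 3 (snd q)) :: real \<times> quat"
    have V: "vector_field M (?V a b c)" for a b c
      by (intro vector_field_frame_combination smooth_on_const)
    have "coef 2 (?V a b c) (z, qone) = b" "coef 3 (?V a b c) (z, qone) = c" for a b c
      by (rule frame_combination[OF q snd_conv])+
    note coefs = this
    have "ext_deriv_2 M (\<omega> C) (?V 1 0 0) (?V 0 1 0) (?V 0 0 1) (z, qone) = 0"
      using closed V q unfolding closed_form_def by blast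
    then show "deriv C z + s * C z = 0"
      unfolding ext_deriv_fundamental[OF C V V V q] coefs by simp
  qed
next
  assume "\<forall>z\<in>I. deriv C z + s * C z = 0"
  then show "closed_form M (\<omega> C)"
    unfolding closed_form_def by (auto simp: ext_deriv_fundamental[OF C])
qed

end

section \<open>The equation for the conformal factor\<close>

text \<open>
  The product of \<open>C\<close> with the integrating factor \<open>exp (s z)\<close> has derivative zero, hence is constant
  on an interval.
\<close>
lemma exponential_ode_iff:
  fixes C :: "real \<Rightarrow> real"
  assumes "open I" "is_interval I" and C: "\<And>z. z \<in> I \<Longrightarrow> (C has_real_derivative deriv C z) (at z)"
  shows "(\<forall>z\<in>I. deriv C z + s * C z = 0) \<longleftrightarrow> (\<exists>C0. \<forall>z\<in>I. C z = C0 * exp (- s * z))"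
proof
  assume ode: "\<forall>z\<in>I. deriv C z + s * C z = 0"
  have "\<exists>c. \<forall>z\<in>I. C z * exp (s * z) = c"
  proof (rule has_field_derivative_zero_constant)
    show "convex I" using assms(2) by (rule is_interval_convex)
    show "((\<lambda>z. C z * exp (s * z)) has_real_derivative 0) (at z within I)" if "z \<in> I" for z
    proof -
      have "deriv C z = - s * C z" using ode that by (simp add: eq_neg_iff_add_eq_0)
      with C[OF that] have "(C has_real_derivative - s * C z) (at z)" by simp
      then have "((\<lambda>z. C z * exp (s * z)) has_real_derivative 0) (at z)"
        by (auto intro!: derivative_eq_intros simp: algebra_simps)
      then show ?thesis by (rule has_field_derivative_at_within)
    qed
  qed
  then obtain c where "\<And>z. z \<in> I \<Longrightarrow> C z * exp (s * z) = c" by blast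
  then have "\<forall>z\<in>I. C z = c * exp (- s * z)"
    by (auto simp: exp_minus divide_simps)
  then show "\<exists>C0. \<forall>z\<in>I. C z = C0 * exp (- s * z)" ..
next
  assume "\<exists>C0. \<forall>z\<in>I. C z = C0 * exp (- s * z)"
  then obtain C0 where C0: "\<And>z. z \<in> I \<Longrightarrow> C z = C0 * exp (- s * z)" by blast
  show "\<forall>z\<in>I. deriv C z + s * C z = 0"
  proof
    fix z assume z: "z \<in> I"
    have "((\<lambda>z. C0 * exp (- s * z)) has_real_derivative - s * C z) (at z)"
      by (auto intro!: derivative_eq_intros simp: C0[OF z])
    then have "(C has_real_derivative - s * C z) (at z)"
      by (rule has_field_derivative_transform_within_open[OF _ assms(1) z]) (simp add: C0)
    then show "deriv C z + s * C z = 0" by (simp add: DERIV_imp_deriv)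
  qed
qed

theorem lemma2p2:
  fixes \<eta> :: "3 \<Rightarrow> quat \<Rightarrow> quat \<Rightarrow> real" and e :: "3 \<Rightarrow> quat \<Rightarrow> quat"
    and I :: "real set" and F C :: "real \<Rightarrow> real"
  assumes "left_invariant_coframe \<eta> e"
    and "open I" and "is_interval I"
    and "smooth_on I F" and "\<And>z. z \<in> I \<Longrightarrow> F z > 0"
    and "smooth_on I C" and "\<And>z. z \<in> I \<Longrightarrow> C z > 0"
  shows "\<forall>s\<in>{1, -1::real}.
    complex_structure (I \<times> S3) (complex_J \<eta> e F s) \<and>
    compatible (I \<times> S3) (metric_g \<eta> F C) (complex_J \<eta> e F s) \<and>
    one_one_form (I \<times> S3) (complex_J \<eta> e F s)
      (fundamental_form (metric_g \<eta> F C) (complex_J \<eta> e F s)) \<and>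
    (closed_form (I \<times> S3) (fundamental_form (metric_g \<eta> F C) (complex_J \<eta> e F s)) \<longleftrightarrow>
      (\<exists>C0. \<forall>z\<in>I. C z = C0 * exp (- s * z)))"
proof
  fix s :: real assume "s \<in> {1, -1}"
  then interpret hermitian_cylinder \<eta> e I F s
    using assms by unfold_locales auto
  show "complex_structure (I \<times> S3) (complex_J \<eta> e F s) \<and>
    compatible (I \<times> S3) (metric_g \<eta> F C) (complex_J \<eta> e F s) \<and>
    one_one_form (I \<times> S3) (complex_J \<eta> e F s)
      (fundamental_form (metric_g \<eta> F C) (complex_J \<eta> e F s)) \<and>
    (closed_form (I \<times> S3) (fundamental_form (metric_g \<eta> F C) (complex_J \<eta> e F s)) \<longleftrightarrow>
      (\<exists>C0. \<forall>z\<in>I. C z = C0 * exp (- s * z)))"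
    using complex_structure_J compatible_J[of C] one_one_form_fundamental[OF assms(6)]
      closed_fundamental_iff_ode[OF assms(6)]
      exponential_ode_iff[OF assms(2,3) smooth_on_open_DERIV[OF assms(2,6)]] by blast
qed

end
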